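(* Let $M=\{u_1,\ldots,u_N\}\subset\mathbb{S}^{n-1}$ be a finite set of $N$ points, let $\xi$ be a spherically contoured random vector in $\mathbb{R}^n$, $T_i=\langle u_i,\xi\rangle$, and $$\Delta(c)=\frac{\sum_{i=1}^N\mathbb{P}(T_i\ge c)-\mathbb{P}\bigl(\max_{1\le i\le N}T_i\ge c\bigr)}{\sum_{i=1}^N\mathbb{P}(T_i\ge c)}.$$ Suppose that the distribution function $F_{R_n}$ of $R_n=\|\xi\|^2$ belongs to $\mathrm{RV}_{-\gamma}$ with $\gamma\in(0,+\infty)$. Then $$ \Delta(c) \sim \frac{1}{N}\sum_{i=1}^N \mathbb{P}\bigl(\widetilde B<\cos^2 \theta(u_i,V_i)\bigr),\qquad c\to+\infty, $$ where $\widetilde B$ is a random variable having the Beta distribution $B_{\gamma+\frac{1}{2},\frac{n-1}{2}}$. Moreover, $$ 0<\lim_{c\to +\infty}\Delta(c)<\bar\Delta := \mathbb{P}\bigl(\widetilde B<\cos^2\theta_*\bigr), $$ that is, the Bonferroni approximation is not tail-valid in this case ($\Delta(c)\not\to0$).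
   Context: $n\ge2$. A spherically contoured random vector is $\xi=r\eta$, where $\eta$ is uniformly distributed on the unit sphere $\mathbb{S}^{n-1}$ and $r>0$ is a random variable independent of $\eta$; $R_n=r^2=\|\xi\|^2$. For each $i$, $S(N_{u_i}M)=\{v\in\mathbb{R}^n:\langle v,u_i\rangle=0,\ \|v\|=1\}$, and $V_i$ is uniformly distributed on $S(N_{u_i}M)$ (independent of $\widetilde B$). For $v\in S(N_{u_i}M)$ the local critical radius $\theta(u_i,v)\in[0,\pi/2]$ is defined by $$\cot\theta(u_i,v)=\max_{j\ne i}\frac{\langle u_j,v\rangle}{1-\langle u_i,u_j\rangle},$$ with $\theta(u_i,v)=\pi/2$ if this maximum is $\le0$. The critical radius is $\theta_*=\min_i\min_{v\in S(N_{u_i}M)}\theta(u_i,v)$; equivalently $\cos\theta_*=\sqrt{(1+\rho_* )/2}$ with $\rho_*=\max_{i\ne j}\langle u_i,u_j\rangle$. $F\in\mathrm{RV}_{-\gamma}$ means $F(x)<1$ for all $x>0$ and $\bar F(\lambda x)/\bar F(x)\to\lambda^{-\gamma}$ as $x\to+\infty$ for all $\lambda>0$, where $\bar F=1-F$. $B_{p,q}$ is the Beta distribution with parameters $p,q>0$. $f\sim g$ means $f/g\to1$. The Bonferroni approximation of $\mathbb{P}(\max_iT_i\ge c)$ is $\sum_i\mathbb{P}(T_i\ge c)$; it is tail-valid if $\Delta(c)\to0$ as $c\to+\infty$.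
   Formalization: N≥2 is assumed (θ is undefined for N=1). 0<lim Δ(c) and the failure of tail-validity exclude M={u,−u}, where Δ(c)=0 for c>0; lim Δ(c)<Δ̄ excludes M={u,−u} and, for n=2, regular N-gons, where equality holds; lim Δ(c)≤Δ̄ is always proved. *)

theory Defs
  imports "HOL-Probability.Probability" "HOL-Library.Landau_Symbols"
begin

section \<open>Probability distributions\<close>

text \<open>The library's \<open>indep_var\<close> needs both variables to have the same value type.\<close>
definition indep_rvs :: "'a measure \<Rightarrow> ('a \<Rightarrow> 'b::topological_space) \<Rightarrow> ('a \<Rightarrow> 'c::topological_space) \<Rightarrow> bool" where
  "indep_rvs P X Y \<longleftrightarrow> X \<in> borel_measurable P \<and> Y \<in> borel_measurable P \<and>
     prob_space.indep_set P {X -` A \<inter> space P |A. A \<in> sets borel} {Y -` A \<inter> space P |A. A \<in> sets borel}"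

text \<open>
  The uniform distribution on a sphere \<open>S\<close> (the unit sphere, or the unit sphere of a linear
  subspace): the Borel probability measure concentrated on \<open>S\<close> that is invariant under every
  linear isometry of the ambient space mapping \<open>S\<close> onto itself. As these isometries act
  transitively on \<open>S\<close>, there is exactly one such measure. For a sphere of dimension 0
  it gives mass 1/2 to each of the two points.
\<close>
definition uniform_on_sphere :: "(real^'n) set \<Rightarrow> (real^'n) measure \<Rightarrow> bool" where
  "uniform_on_sphere S \<mu> \<longleftrightarrow>
     prob_space \<mu> \<and> sets \<mu> = sets borel \<and> emeasure \<mu> S = 1 \<and>
     (\<forall>f. orthogonal_transformation f \<and> f ` S = S \<longrightarrow> distr \<mu> borel f = \<mu>)"

definition spherically_contoured :: "'a measure \<Rightarrow> ('a \<Rightarrow> real^'n) \<Rightarrow> bool" where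
  "spherically_contoured P \<xi> \<longleftrightarrow>
     (\<exists>(r :: 'a \<Rightarrow> real) \<eta>.
        indep_rvs P r \<eta> \<and>
        (AE \<omega> in P. 0 < r \<omega>) \<and>
        uniform_on_sphere (sphere 0 1) (distr P borel \<eta>) \<and>
        (\<forall>\<omega>\<in>space P. \<xi> \<omega> = r \<omega> *\<^sub>R \<eta> \<omega>))"

definition beta_density :: "real \<Rightarrow> real \<Rightarrow> real \<Rightarrow> real" where
  "beta_density p q x =
     (if 0 < x \<and> x < 1 then x powr (p - 1) * (1 - x) powr (q - 1) / Beta p q else 0)"

definition RV :: "real \<Rightarrow> (real \<Rightarrow> real) set" where
  "RV \<alpha> = {F. (\<forall>x>0. F x < 1) \<and>
     (\<forall>l>0. ((\<lambda>x. (1 - F (l * x)) / (1 - F x)) \<longlongrightarrow> l powr \<alpha>) at_top)}"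

section \<open>Critical radii of a finite subset of the unit sphere\<close>

definition unit_normals :: "real^'n \<Rightarrow> (real^'n) set" where
  "unit_normals u = {v. v \<bullet> u = 0 \<and> norm v = 1}"

definition max_cot :: "(real^'n) set \<Rightarrow> real^'n \<Rightarrow> real^'n \<Rightarrow> real" where
  "max_cot M u v = Max ((\<lambda>w. (w \<bullet> v) / (1 - u \<bullet> w)) ` (M - {u}))"

definition local_critical_radius :: "(real^'n) set \<Rightarrow> real^'n \<Rightarrow> real^'n \<Rightarrow> real" where
  "local_critical_radius M u v =
     (THE \<theta>. 0 \<le> \<theta> \<and> \<theta> \<le> pi / 2 \<and>
        (if max_cot M u v \<le> 0 then \<theta> = pi / 2 else cot \<theta> = max_cot M u v))"

lemma local_critical_radius_ex1:
  "\<exists>!\<theta>. 0 \<le> \<theta> \<and> \<theta> \<le> pi / 2 \<and>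
     (if max_cot M u v \<le> 0 then \<theta> = pi / 2 else cot \<theta> = max_cot M u v)"
proof (cases "max_cot M u v \<le> 0")
  case True
  then show ?thesis
    by (auto intro!: ex1I[of _ "pi / 2"])
next
  case False
  define m where "m = max_cot M u v"
  have m: "m > 0"
    using False by (simp add: m_def)
  have "0 \<le> \<theta> \<and> \<theta> \<le> pi / 2 \<and> cot \<theta> = m \<longleftrightarrow> \<theta> = arctan (1 / m)" for \<theta>
  proof
    assume *: "0 \<le> \<theta> \<and> \<theta> \<le> pi / 2 \<and> cot \<theta> = m"
    have "cot (pi / 2) = (0 :: real)"
      by (simp add: cot_def)
    then have "\<theta> \<noteq> pi / 2"
      using * m by (metis less_irrefl)
    moreover have "tan \<theta> = 1 / m"
      using * m by (auto simp: cot_def tan_def field_simps split: if_splits)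
    ultimately show "\<theta> = arctan (1 / m)"
      using * by (intro arctan_unique[symmetric]) auto
  next
    assume \<theta>: "\<theta> = arctan (1 / m)"
    have "cot \<theta> = 1 / tan \<theta>"
      by (simp add: cot_def tan_def)
    then have "cot \<theta> = m"
      by (simp only: \<theta> tan_arctan) simp
    then show "0 \<le> \<theta> \<and> \<theta> \<le> pi / 2 \<and> cot \<theta> = m"
      using \<theta> m arctan_ubound[of "1 / m"] by auto
  qed
  then show ?thesis
    using False by (simp add: m_def)
qed

text \<open>The infimum is attained, since each \<open>unit_normals u\<close> is compact and the local
  critical radius is continuous in \<open>v\<close>.\<close>
definition critical_radius :: "(real^'n) set \<Rightarrow> real" where
  "critical_radius M = (MIN u\<in>M. INF v\<in>unit_normals u. local_critical_radius M u v)"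

section \<open>Bonferroni approximation\<close>

definition bonferroni_sum :: "'a measure \<Rightarrow> ('a \<Rightarrow> real^'n) \<Rightarrow> (real^'n) set \<Rightarrow> real \<Rightarrow> real" where
  "bonferroni_sum P \<xi> M c = (\<Sum>u\<in>M. measure P {\<omega>\<in>space P. u \<bullet> \<xi> \<omega> \<ge> c})"

definition bonferroni_error :: "'a measure \<Rightarrow> ('a \<Rightarrow> real^'n) \<Rightarrow> (real^'n) set \<Rightarrow> real \<Rightarrow> real" where
  "bonferroni_error P \<xi> M c =
     (bonferroni_sum P \<xi> M c - measure P {\<omega>\<in>space P. (MAX u\<in>M. u \<bullet> \<xi> \<omega>) \<ge> c})
       / bonferroni_sum P \<xi> M c"

definition bonferroni_tail_valid :: "'a measure \<Rightarrow> ('a \<Rightarrow> real^'n) \<Rightarrow> (real^'n) set \<Rightarrow> bool" where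
  "bonferroni_tail_valid P \<xi> M \<longleftrightarrow> (bonferroni_error P \<xi> M \<longlongrightarrow> 0) at_top"

section \<open>Degenerate configurations\<close>

text \<open>
  For an antipodal pair the events \<open>u \<bullet> \<xi> \<omega> \<ge> c\<close> and \<open>- u \<bullet> \<xi> \<omega> \<ge> c\<close> are disjoint when \<open>c > 0\<close>,
  so the relative error vanishes and the limit is 0. For a regular polygon in the plane, all
  local critical radii coincide with the critical radius, so the upper bound on the limit
  is attained.
\<close>
definition antipodal_pair :: "(real^'n) set \<Rightarrow> bool" where
  "antipodal_pair M \<longleftrightarrow> (\<exists>u. M = {u, - u})"

definition regular_polygon :: "(real^'n) set \<Rightarrow> bool" where
  "regular_polygon M \<longleftrightarrow>
     (\<exists>a b. norm a = 1 \<and> norm b = 1 \<and> a \<bullet> b = 0 \<and>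
        M = (\<lambda>k. cos (2 * pi * real k / real (card M)) *\<^sub>R a
               + sin (2 * pi * real k / real (card M)) *\<^sub>R b) ` {..<card M})"

end

theory Submission
  imports Defs
begin

text \<open>
  Write \<open>\<xi> = r \<eta>\<close> and let \<open>m y\<close> be the maximum of \<open>u \<bullet> y\<close> over \<open>u \<in> M\<close>. Conditioning on \<open>\<eta>\<close>,
  regular variation and dominated convergence (the dominating constant exists because
  \<open>m \<le> 1\<close> on the sphere) show that, relative to \<open>P (R > c\<^sup>2)\<close>, the probabilities of
  \<open>u \<bullet> \<xi> \<ge> c\<close> and of \<open>m \<xi> \<ge> c\<close> converge to the moments of order \<open>2 \<gamma>\<close> of the positive parts
  of \<open>u \<bullet> \<eta>\<close> and \<open>m \<eta>\<close>. The second moment splits according to the almost surely unique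
  maximizer \<open>u\<close>. With \<open>b = (u \<bullet> \<eta>)\<^sup>2\<close> and \<open>v\<close> the direction of the part of \<open>\<eta>\<close> orthogonal to \<open>u\<close>,
  the point \<open>u\<close> is the maximizer iff \<open>u \<bullet> \<eta> > 0\<close> and \<open>b \<ge> cos\<^sup>2 \<theta>(u, v)\<close>; \<open>b\<close> and \<open>v\<close> are
  independent, \<open>v\<close> is uniform, and \<open>b\<close> weighted by \<open>b powr \<gamma>\<close> has the law of \<open>B\<close>.

  The uniform distribution on a sphere is determined by its invariance under reflections: for
  two such measures the integrals of \<open>exp (a \<bullet> y)\<close> depend only on \<open>norm a\<close> and agree by Fubini,
  so Stone-Weierstrass applies. The law of \<open>b\<close> is found from a moment recursion.

  For strictness, uniform measures have full support, so equality in either bound forces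
  \<open>max_cot M u v\<close>, cut off at \<open>0\<close>, to be constant. The value \<open>0\<close> forces an antipodal pair; a
  positive value forces the spheres of unit normals to be finite, hence dimension two and
  equal gaps between neighbouring points.
\<close>

section \<open>Uniqueness of the uniform distribution on a sphere\<close>

text \<open>Closed sets generate the Borel sets and are stable under intersection. The indicator of
  a closed set is a pointwise limit of continuous functions with values between 0 and 1, so
  dominated convergence passes from the test functions to closed sets.\<close>

lemma measure_eqI_continuous:
  fixes M N :: "'a::metric_space measure"
  assumes M: "finite_measure M" "sets M = sets borel"
    and N: "finite_measure N" "sets N = sets borel"
    and eq: "\<And>f :: 'a \<Rightarrow> real. continuous_on UNIV f \<Longrightarrow> (\<And>x. 0 \<le> f x) \<Longrightarrow> (\<And>x. f x \<le> 1) \<Longrightarrow> integral\<^sup>L M f = integral\<^sup>L N f"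
  shows "M = N"
proof -
  interpret M: finite_measure M by fact
  interpret N: finite_measure N by fact
  have sp: "space M = UNIV" "space N = UNIV"
    using sets_eq_imp_space_eq[OF M(2)] sets_eq_imp_space_eq[OF N(2)] by auto
  have closed_eq: "emeasure M C = emeasure N C" if C: "closed C" for C :: "'a set"
  \<comment> \<open>\<open>infdist x {}\<close> is 0 by convention, so for empty \<open>C\<close>
    the functions below would be constantly 1.\<close>
  proof (cases "C = {}")
    case False
    define f where "f k x = max 0 (1 - real k * infdist x C)" for k :: nat and x
    have cont: "continuous_on UNIV (f k)" for k
      unfolding f_def by (intro continuous_intros)
    have bounds: "0 \<le> f k x" "f k x \<le> 1" for k x
      by (auto simp: f_def infdist_nonneg)
    have lim: "(\<lambda>k. f k x) \<longlonglongrightarrow> indicator C x" for x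
    proof (cases "x \<in> C")
      case False
      then have pos: "infdist x C > 0"
        using C \<open>C \<noteq> {}\<close> infdist_pos_not_in_closed by auto
      obtain k0 :: nat where k0: "1 / infdist x C < real k0"
        using reals_Archimedean2 by blast
      have "f k x = 0" if "k \<ge> k0" for k
      proof -
        have "1 < real k0 * infdist x C"
          using k0 pos by (simp add: field_simps)
        also have "\<dots> \<le> real k * infdist x C"
          using that pos by (intro mult_right_mono) auto
        finally show ?thesis by (simp add: f_def)
      qed
      then have "eventually (\<lambda>k. f k x = indicator C x) sequentially"
        using False by (auto simp: eventually_sequentially)
      then show ?thesis
        by (rule tendsto_eventually)
    qed (simp add: f_def)
    have limint: "(\<lambda>k. integral\<^sup>L L (f k)) \<longlonglongrightarrow> measure L C"
      if L: "finite_measure L" "sets L = sets borel" for L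
    proof -
      interpret L: finite_measure L by fact
      have "(\<lambda>k. integral\<^sup>L L (f k)) \<longlonglongrightarrow> integral\<^sup>L L (indicator C)"
      proof (rule integral_dominated_convergence[where w = "\<lambda>_. 1"])
        show "f k \<in> borel_measurable L" for k
          using borel_measurable_continuous_onI[OF cont] L(2) measurable_cong_sets by blast
        show "indicator C \<in> borel_measurable L"
          using C L(2) by (intro borel_measurable_indicator) simp
      qed (use lim bounds in auto)
      then show ?thesis
        using C L(2) sets_eq_imp_space_eq[OF L(2)] by simp
    qed
    have "measure M C = measure N C"
      using limint[OF M] limint[OF N] LIMSEQ_unique eq[OF cont bounds] by auto
    then show ?thesis
      by (simp add: M.emeasure_eq_measure N.emeasure_eq_measure)
  qed simp
  show ?thesis
  proof (rule measure_eqI_generator_eq[where \<Omega> = UNIV and E = "{C. closed C}" and A = "\<lambda>_. UNIV"])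
    show "Int_stable {C :: 'a set. closed C}"
      by (auto simp: Int_stable_def)
    show "sets M = sigma_sets UNIV {C. closed C}" "sets N = sigma_sets UNIV {C. closed C}"
      unfolding M(2) N(2) by (simp_all add: borel_eq_closed)
  qed (use closed_eq in auto)
qed

text \<open>By Stone-Weierstrass, \<open>R\<close> is uniformly dense in the continuous functions on
  the compact set \<open>K\<close>, and both measures ignore the complement of \<open>K\<close>. As
  the total masses are finite, a small uniform error gives a small error of the integrals.\<close>

lemma measure_eqI_function_ring:
  fixes M N :: "'a::metric_space measure"
  assumes M: "finite_measure M" "sets M = sets borel" "AE x in M. x \<in> K"
    and N: "finite_measure N" "sets N = sets borel" "AE x in N. x \<in> K"
    and R: "function_ring_on R K" "\<And>f. f \<in> R \<Longrightarrow> f \<in> borel_measurable borel"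
    and eq: "\<And>f. f \<in> R \<Longrightarrow> integral\<^sup>L M f = integral\<^sup>L N f"
  shows "M = N"
proof (rule measure_eqI_continuous)
  interpret R: function_ring_on R K by fact
  fix f :: "'a \<Rightarrow> real"
  assume f: "continuous_on UNIV f" and bounds: "\<And>x. 0 \<le> f x" "\<And>x. f x \<le> 1"
  have close: "\<bar>integral\<^sup>L L f - integral\<^sup>L L g\<bar> \<le> e * measure L UNIV"
    if L: "finite_measure L" "sets L = sets borel" "AE x in L. x \<in> K"
      and g: "g \<in> R" "\<And>x. x \<in> K \<Longrightarrow> \<bar>f x - g x\<bar> < e" for L g e
  proof -
    interpret L: finite_measure L by fact
    have meas: "f \<in> borel_measurable L" "g \<in> borel_measurable L"
      using borel_measurable_continuous_onI[OF f] R(2)[OF g(1)] L(2) measurable_cong_sets by blast+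
    have f_int: "integrable L f"
      by (rule L.integrable_const_bound[where B = 1]) (use bounds meas in auto)
    obtain b where b: "\<And>x. x \<in> K \<Longrightarrow> \<bar>g x\<bar> \<le> b"
      using compact_imp_bounded[OF compact_continuous_image[OF R.continuous[OF g(1)] R.compact]]
      by (auto simp: bounded_iff)
    have g_int: "integrable L g"
      by (rule L.integrable_const_bound[where B = b]) (use L(3) b meas in auto)
    have "norm (integral\<^sup>L L (\<lambda>x. f x - g x)) \<le> integral\<^sup>L L (\<lambda>x. norm (f x - g x))"
      by (rule integral_norm_bound)
    also have "\<dots> \<le> integral\<^sup>L L (\<lambda>_. e)"
    proof (rule integral_mono_AE)
      show "AE x in L. norm (f x - g x) \<le> e"
        using L(3) by eventually_elim (use g(2) in force)
    qed (use f_int g_int in auto)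
    also have "\<dots> = e * measure L UNIV"
      using sets_eq_imp_space_eq[OF L(2)] by simp
    finally show ?thesis
      using f_int g_int by simp
  qed
  show "integral\<^sup>L M f = integral\<^sup>L N f"
  proof (rule ccontr)
    assume ne: "integral\<^sup>L M f \<noteq> integral\<^sup>L N f"
    define d where "d = \<bar>integral\<^sup>L M f - integral\<^sup>L N f\<bar>"
    \<comment> \<open>The summand 1 makes \<open>c\<close> positive and leaves a total error of at
      most \<open>d / c * (c - 1)\<close>, which is less than \<open>d\<close>.\<close>
    define c where "c = measure M UNIV + measure N UNIV + 1"
    have "d > 0" "c > 0"
      using ne by (auto simp: d_def c_def add_nonneg_pos)
    then have "d / c > 0" by simp
    then obtain g where g: "g \<in> R" "\<And>x. x \<in> K \<Longrightarrow> \<bar>f x - g x\<bar> < d / c"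
      using R.Stone_Weierstrass_basic[OF continuous_on_subset[OF f]] by blast
    have "d \<le> d / c * measure M UNIV + d / c * measure N UNIV"
      using close[OF M g] close[OF N g] eq[OF g(1)] unfolding d_def by linarith
    also have "\<dots> = d / c * (c - 1)"
      by (metis c_def add_diff_cancel_right' distrib_left)
    also have "\<dots> < d"
      using \<open>d > 0\<close> \<open>c > 0\<close> by (simp add: field_simps)
    finally show False by simp
  qed
qed (use assms in auto)

section \<open>Reflections and measures invariant under them\<close>

text \<open>For \<open>d = 0\<close> division by zero gives 0 and the map is the identity, so it is
  a linear isometry for every \<open>d\<close>.\<close>

definition refl_along :: "'a::euclidean_space \<Rightarrow> 'a \<Rightarrow> 'a" where
  "refl_along d x = x - (2 * (x \<bullet> d) / (d \<bullet> d)) *\<^sub>R d"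

lemma linear_refl_along: "linear (refl_along d)"
  by (auto intro!: linearI simp: refl_along_def inner_add_left scaleR_add_left add_divide_distrib algebra_simps)

lemma refl_along_inner: "refl_along d x \<bullet> refl_along d y = x \<bullet> y"
  by (cases "d = 0") (simp_all add: refl_along_def inner_diff_left inner_diff_right inner_commute field_simps)

lemma orthogonal_transformation_refl_along: "orthogonal_transformation (refl_along d)"
  by (simp add: orthogonal_transformation_def linear_refl_along refl_along_inner)

lemma norm_refl_along [simp]: "norm (refl_along d x) = norm x"
  by (simp add: norm_eq_sqrt_inner refl_along_inner)

lemma refl_along_invol [simp]: "refl_along d (refl_along d x) = x"
proof (cases "d = 0")
  case False
  then show ?thesis
    by (simp add: refl_along_def inner_diff_left algebra_simps flip: scaleR_add_left)
qed (simp add: refl_along_def)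

lemma refl_along_orthogonal: "x \<bullet> d = 0 \<Longrightarrow> refl_along d x = x"
  by (simp add: refl_along_def)

text \<open>This is the reflection in the perpendicular bisector of \<open>x\<close> and
  \<open>y\<close>. It makes reflections transitive on spheres, and \<open>x - y\<close> stays in
  every subspace that contains both points.\<close>

lemma refl_along_diff:
  assumes "norm x = norm y"
  shows "refl_along (x - y) x = y"
proof (cases "x = y")
  case False
  have "x \<bullet> x = y \<bullet> y"
    using assms by (simp add: norm_eq)
  then have "(x - y) \<bullet> (x - y) = 2 * (x \<bullet> (x - y))"
    by (simp add: inner_diff_left inner_diff_right inner_commute)
  moreover have "(x - y) \<bullet> (x - y) \<noteq> 0"
    using False by simp
  ultimately show ?thesis
    by (simp add: refl_along_def)
qed (simp add: refl_along_def)

lemma refl_along_in_subspace: "subspace W \<Longrightarrow> d \<in> W \<Longrightarrow> x \<in> W \<Longrightarrow> refl_along d x \<in> W"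
  by (simp add: refl_along_def subspace_diff subspace_scale)

lemma borel_measurable_refl_along [measurable]: "refl_along d \<in> borel_measurable borel"
  by (intro borel_measurable_continuous_onI linear_continuous_on) (simp add: linear_refl_along linear_linear)

text \<open>
  Every isometry needed below is a reflection. Unlike a general isometry of the sphere of \<open>W\<close>,
  a reflection along a vector of \<open>W\<close> fixes the orthogonal complement of \<open>W\<close>.
\<close>
definition refl_uniform :: "'a::euclidean_space set \<Rightarrow> 'a measure \<Rightarrow> bool" where
  "refl_uniform W \<mu> \<longleftrightarrow> prob_space \<mu> \<and> sets \<mu> = sets borel \<and> (AE x in \<mu>. x \<in> W \<and> norm x = 1) \<and>
     (\<forall>d\<in>W. distr \<mu> borel (refl_along d) = \<mu>)"

lemma refl_uniformD:
  assumes "refl_uniform W \<mu>"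
  shows "prob_space \<mu>" "sets \<mu> = sets borel" "AE x in \<mu>. x \<in> W \<and> norm x = 1"
    and "d \<in> W \<Longrightarrow> distr \<mu> borel (refl_along d) = \<mu>"
  using assms unfolding refl_uniform_def by blast+

text \<open>A reflection along a vector of \<open>W\<close> maps \<open>S\<close> into itself and is
  its own inverse, hence maps \<open>S\<close> onto \<open>S\<close>.\<close>

lemma uniform_on_sphere_imp_refl_uniform:
  assumes S: "uniform_on_sphere S \<mu>" "S = {x\<in>W. norm x = 1}" and W: "subspace W"
  shows "refl_uniform W \<mu>"
  unfolding refl_uniform_def
proof (intro conjI ballI)
  interpret prob_space \<mu>
    using S(1) by (simp add: uniform_on_sphere_def)
  show "prob_space \<mu>"
    by (rule prob_space_axioms)
  show sets: "sets \<mu> = sets borel"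
    using S(1) by (simp add: uniform_on_sphere_def)
  have "emeasure \<mu> S = 1"
    using S(1) by (simp add: uniform_on_sphere_def)
  \<comment> \<open>\<open>emeasure\<close> is 0 on nonmeasurable sets by default, so mass 1 forces
    measurability.\<close>
  then have "S \<in> sets \<mu>"
    by (metis emeasure_notin_sets zero_neq_one)
  then have "AE x in \<mu>. x \<in> S"
    using \<open>emeasure \<mu> S = 1\<close> by (simp add: AE_in_set_eq_1 measure_def)
  then show "AE x in \<mu>. x \<in> W \<and> norm x = 1"
    using S(2) by simp
  fix d assume d: "d \<in> W"
  have "refl_along d ` S = S"
  proof
    show le: "refl_along d ` S \<subseteq> S"
      using W d by (auto simp: S(2) refl_along_in_subspace)
    show "S \<subseteq> refl_along d ` S"
    proof
      fix x assume "x \<in> S"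
      then have "refl_along d x \<in> S" using le by blast
      then show "x \<in> refl_along d ` S"
        by (metis imageI refl_along_invol)
    qed
  qed
  then show "distr \<mu> borel (refl_along d) = \<mu>"
    using S(1) orthogonal_transformation_refl_along unfolding uniform_on_sphere_def by blast
qed

text \<open>The coefficient \<open>c\<close> puts constants and scalar multiples among the
  generators. Closure under products follows because frequencies add and, for a subspace
  \<open>W\<close>, their sums stay in \<open>W\<close>.\<close>

inductive_set exp_ring :: "'a::euclidean_space set \<Rightarrow> ('a \<Rightarrow> real) set" for W where
  exp: "a \<in> W \<Longrightarrow> (\<lambda>y. c * exp (a \<bullet> y)) \<in> exp_ring W"
| add: "f \<in> exp_ring W \<Longrightarrow> g \<in> exp_ring W \<Longrightarrow> (\<lambda>y. f y + g y) \<in> exp_ring W"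

lemma exp_ring_continuous: "f \<in> exp_ring W \<Longrightarrow> continuous_on S f"
  by (induction rule: exp_ring.induct) (auto intro!: continuous_intros)

lemma exp_ring_mult:
  assumes W: "subspace W" and f: "f \<in> exp_ring W" and g: "g \<in> exp_ring W"
  shows "(\<lambda>y. f y * g y) \<in> exp_ring W"
  using f
proof induction
  case (exp a c)
  from g show ?case
  proof induction
    case (exp b d)
    have "(\<lambda>y. (c * d) * exp ((a + b) \<bullet> y)) \<in> exp_ring W"
      using W exp \<open>a \<in> W\<close> by (intro exp_ring.exp) (simp add: subspace_add)
    then show ?case
      by (simp add: inner_add_left exp_add mult_ac)
  next
    case (add f g)
    then show ?case
      using exp_ring.add[OF add.IH] by (simp add: distrib_left)
  qed
next
  case (add f1 f2)
  then show ?case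
    using exp_ring.add[OF add.IH] by (simp add: distrib_right)
qed

text \<open>The exponential with frequency \<open>x - y\<close> separates \<open>x\<close> from
  \<open>y\<close>, and frequency 0 yields the constants.\<close>

lemma function_ring_on_exp_ring:
  assumes "subspace W" "compact K" "K \<subseteq> W"
  shows "function_ring_on (exp_ring W) K"
proof
  show "f \<in> exp_ring W \<Longrightarrow> g \<in> exp_ring W \<Longrightarrow> (\<lambda>x. f x * g x) \<in> exp_ring W" for f g
    using assms exp_ring_mult by blast
  show "(\<lambda>_. c) \<in> exp_ring W" for c
    using exp_ring.exp[of 0 W c] assms by (simp add: subspace_0)
  fix x y assume xy: "x \<in> K" "y \<in> K" "x \<noteq> y"
  then have "(x - y) \<bullet> x \<noteq> (x - y) \<bullet> y"
    by (metis eq_iff_diff_eq_0 inner_diff_right inner_eq_zero_iff)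
  moreover have "(\<lambda>z. 1 * exp ((x - y) \<bullet> z)) \<in> exp_ring W"
    using assms xy by (intro exp_ring.exp subspace_diff) auto
  ultimately show "\<exists>f\<in>exp_ring W. f x \<noteq> f y"
    by (metis exp_inj_iff mult_1)
qed (use assms exp_ring_continuous exp_ring.add in auto)

text \<open>The reflection along \<open>x - y\<close> carries \<open>x\<close> to \<open>y\<close>
  and preserves both \<mu> and the inner product.\<close>

lemma refl_uniform_integral_inner:
  fixes \<phi> :: "real \<Rightarrow> real"
  assumes \<mu>: "refl_uniform W \<mu>" and W: "subspace W" and x: "x \<in> W" "y \<in> W" "norm x = norm y"
    and [measurable]: "\<phi> \<in> borel_measurable borel"
  shows "(\<integral>z. \<phi> (x \<bullet> z) \<partial>\<mu>) = (\<integral>z. \<phi> (y \<bullet> z) \<partial>\<mu>)"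
proof -
  have [measurable_cong, simp]: "sets \<mu> = sets borel"
    by (rule refl_uniformD(2)[OF \<mu>])
  define f where "f = refl_along (x - y)"
  have "distr \<mu> borel f = \<mu>"
    using refl_uniformD(4)[OF \<mu>] W x by (simp add: f_def subspace_diff)
  then have "(\<integral>z. \<phi> (y \<bullet> z) \<partial>\<mu>) = (\<integral>z. \<phi> (y \<bullet> z) \<partial>distr \<mu> borel f)"
    by simp
  also have "\<dots> = (\<integral>z. \<phi> (y \<bullet> f z) \<partial>\<mu>)"
    unfolding f_def by (rule integral_distr) measurable
  also have "\<dots> = (\<integral>z. \<phi> (f x \<bullet> f z) \<partial>\<mu>)"
    using x by (simp add: f_def refl_along_diff)
  finally show ?thesis
    by (simp add: f_def refl_along_inner)
qed

text \<open>For unit vectors \<open>x\<close>, \<open>y\<close>, integrate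
  \<open>exp (norm a * (x \<bullet> y))\<close> over both measures. In either order the inner
  integral is constant by invariance, so the double integral equals the integral of
  \<open>exp (a \<bullet> y)\<close> under each of the two measures. Such exponentials determine a
  measure on the compact sphere of \<open>W\<close>.\<close>

lemma refl_uniform_unique:
  fixes \<mu> \<nu> :: "'a::euclidean_space measure"
  assumes \<mu>: "refl_uniform W \<mu>" and \<nu>: "refl_uniform W \<nu>" and W: "subspace W"
  shows "\<mu> = \<nu>"
proof -
  interpret \<mu>: prob_space \<mu> by (rule refl_uniformD(1)[OF \<mu>])
  interpret \<nu>: prob_space \<nu> by (rule refl_uniformD(1)[OF \<nu>])
  interpret pair_sigma_finite \<mu> \<nu> ..
  have sets [measurable_cong, simp]: "sets \<mu> = sets borel" "sets \<nu> = sets borel"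
    by (rule refl_uniformD[OF \<mu>] refl_uniformD[OF \<nu>])+
  have ae: "AE x in \<mu>. x \<in> W \<and> norm x = 1" "AE x in \<nu>. x \<in> W \<and> norm x = 1"
    by (rule refl_uniformD[OF \<mu>] refl_uniformD[OF \<nu>])+
  define K where "K = {x\<in>W. norm x = 1}"
  have K: "compact K" "K \<subseteq> W"
  proof -
    have "K = W \<inter> sphere 0 1" by (auto simp: K_def)
    then show "compact K"
      using closed_subspace[OF W] by (simp add: closed_Int_compact)
  qed (auto simp: K_def)
  have bound: "norm (exp (a \<bullet> y)) \<le> exp (norm a)" if "norm y = 1" for a y :: 'a
    using Cauchy_Schwarz_ineq2[of a y] that by simp
  have int_exp: "integrable L (\<lambda>y. exp (a \<bullet> y))" if "prob_space L" "sets L = sets borel" "AE x in L. x \<in> W \<and> norm x = 1"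
    for L and a :: 'a
  proof -
    interpret L: prob_space L by fact
    note that(2)[measurable_cong]
    show ?thesis
    proof (rule L.integrable_const_bound[where B = "exp (norm a)"])
      show "AE y in L. norm (exp (a \<bullet> y)) \<le> exp (norm a)"
        using that(3) by eventually_elim (use bound in blast)
    qed measurable
  qed
  have exp_eq: "(\<integral>y. exp (a \<bullet> y) \<partial>\<mu>) = (\<integral>y. exp (a \<bullet> y) \<partial>\<nu>)" if a: "a \<in> W" for a
  proof -
    \<comment> \<open>All vectors \<open>s *\<^sub>R x\<close> with \<open>x\<close> a unit vector
      of \<open>W\<close> have the norm of \<open>a\<close>, so they give the same exponential
      integral as \<open>a\<close>.\<close>
    define s where "s = norm a"
    have const: "(\<integral>y. exp ((s *\<^sub>R x) \<bullet> y) \<partial>L) = (\<integral>y. exp (a \<bullet> y) \<partial>L)"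
      if "refl_uniform W L" "x \<in> W" "norm x = 1" for L x
      using that a W by (intro refl_uniform_integral_inner[of W]) (auto simp: s_def subspace_scale)
    have "(\<integral>y. exp (a \<bullet> y) \<partial>\<mu>) = (\<integral>x. (\<integral>y. exp (a \<bullet> y) \<partial>\<mu>) \<partial>\<nu>)"
      by (simp add: \<nu>.prob_space)
    also have "\<dots> = (\<integral>x. (\<integral>y. exp ((s *\<^sub>R x) \<bullet> y) \<partial>\<mu>) \<partial>\<nu>)"
      proof (rule integral_cong_AE)
      show "AE x in \<nu>. (\<integral>y. exp (a \<bullet> y) \<partial>\<mu>) = (\<integral>y. exp ((s *\<^sub>R x) \<bullet> y) \<partial>\<mu>)"
        using ae(2) by eventually_elim (use const[OF \<mu>] in metis)
    qed measurable
    also have "\<dots> = (\<integral>y. (\<integral>x. exp ((s *\<^sub>R x) \<bullet> y) \<partial>\<nu>) \<partial>\<mu>)"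
    proof (rule Fubini_integral)
      have "AE z in \<mu> \<Otimes>\<^sub>M \<nu>. norm (fst z) = 1 \<and> norm (snd z) = 1"
      proof (rule AE_pair_measure)
        show "AE x in \<mu>. AE y in \<nu>. norm (fst (x, y)) = 1 \<and> norm (snd (x, y)) = 1"
          using ae(1)
        proof eventually_elim
          case (elim x)
          then show ?case using ae(2) by (auto elim: eventually_mono)
        qed
        show "{z \<in> space (\<mu> \<Otimes>\<^sub>M \<nu>). norm (fst z) = 1 \<and> norm (snd z) = 1} \<in> sets (\<mu> \<Otimes>\<^sub>M \<nu>)"
          by measurable
      qed
      then show "integrable (\<mu> \<Otimes>\<^sub>M \<nu>) (\<lambda>(y, x). exp ((s *\<^sub>R x) \<bullet> y))"
      proof (intro integrableI_bounded_set[where A = UNIV and B = "exp s"])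
        assume *: "AE z in \<mu> \<Otimes>\<^sub>M \<nu>. norm (fst z) = 1 \<and> norm (snd z) = 1"
        show "AE z in \<mu> \<Otimes>\<^sub>M \<nu>. z \<in> UNIV \<longrightarrow> norm (case z of (y, x) \<Rightarrow> exp ((s *\<^sub>R x) \<bullet> y)) \<le> exp s"
          using *
        proof eventually_elim
          case (elim z)
          then show ?case
            using bound[of "fst z" "s *\<^sub>R snd z"] by (auto simp: case_prod_beta s_def)
        qed
        have "emeasure (\<mu> \<Otimes>\<^sub>M \<nu>) (space (\<mu> \<Otimes>\<^sub>M \<nu>)) < \<infinity>"
          using \<nu>.emeasure_pair_measure_Times[OF sets.top sets.top, of \<mu>]
          by (simp add: space_pair_measure \<mu>.emeasure_space_1 \<nu>.emeasure_space_1)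
        then show "emeasure (\<mu> \<Otimes>\<^sub>M \<nu>) UNIV < \<infinity>"
          by (simp add: space_pair_measure sets_eq_imp_space_eq[OF sets(1)] sets_eq_imp_space_eq[OF sets(2)])
        show "UNIV \<in> sets (\<mu> \<Otimes>\<^sub>M \<nu>)"
          using sets.top[of "\<mu> \<Otimes>\<^sub>M \<nu>"]
          by (simp add: space_pair_measure sets_eq_imp_space_eq[OF sets(1)] sets_eq_imp_space_eq[OF sets(2)])
      qed auto
    qed
    also have "\<dots> = (\<integral>y. (\<integral>x. exp ((s *\<^sub>R y) \<bullet> x) \<partial>\<nu>) \<partial>\<mu>)"
      by (simp add: inner_commute)
    also have "\<dots> = (\<integral>y. (\<integral>x. exp (a \<bullet> x) \<partial>\<nu>) \<partial>\<mu>)"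
      proof (rule integral_cong_AE)
      show "AE y in \<mu>. (\<integral>x. exp ((s *\<^sub>R y) \<bullet> x) \<partial>\<nu>) = (\<integral>x. exp (a \<bullet> x) \<partial>\<nu>)"
        using ae(1) by eventually_elim (use const[OF \<nu>] in metis)
    qed measurable
    also have "\<dots> = (\<integral>x. exp (a \<bullet> x) \<partial>\<nu>)"
      by (simp add: \<mu>.prob_space)
    finally show ?thesis .
  qed
  show ?thesis
  proof (rule measure_eqI_function_ring[where K = K and R = "exp_ring W"])
    show "f \<in> borel_measurable borel" if "f \<in> exp_ring W" for f
      using that exp_ring_continuous borel_measurable_continuous_onI by blast
    fix f assume "f \<in> exp_ring W"
    then have "integrable \<mu> f \<and> integrable \<nu> f \<and> integral\<^sup>L \<mu> f = integral\<^sup>L \<nu> f"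
    proof induction
      case (exp a c)
      then show ?case
        using int_exp[OF _ _ ae(1)] int_exp[OF _ _ ae(2)] exp_eq
        by (simp add: \<mu>.prob_space_axioms \<nu>.prob_space_axioms)
    qed simp
    then show "integral\<^sup>L \<mu> f = integral\<^sup>L \<nu> f" by simp
  qed (use K W ae function_ring_on_exp_ring in \<open>auto simp: K_def \<mu>.finite_measure_axioms \<nu>.finite_measure_axioms\<close>)
qed

section \<open>Moments of the uniform distribution\<close>

lemma borel_measurable_beta_density [measurable]: "beta_density p q \<in> borel_measurable borel"
  unfolding beta_density_def by measurable

lemma Beta_real_pos: "p > 0 \<Longrightarrow> q > 0 \<Longrightarrow> Beta p q > 0" for p q :: real
  by (simp add: Beta_def)

lemma beta_density_nonneg: "p > 0 \<Longrightarrow> q > 0 \<Longrightarrow> 0 \<le> beta_density p q x"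
  using Beta_real_pos[of p q] by (simp add: beta_density_def)

lemma beta_density_pos: "p > 0 \<Longrightarrow> q > 0 \<Longrightarrow> 0 < x \<Longrightarrow> x < 1 \<Longrightarrow> 0 < beta_density p q x"
  using Beta_real_pos[of p q] by (simp add: beta_density_def)

text \<open>Weighting by a power shifts the first parameter. Integer exponents give the moments of
  the Beta law; the exponent \<gamma> leads from the law of the squared component to the law of
  \<open>B\<close>.\<close>

lemma powr_mult_beta_density:
  assumes "p > 0" "q > 0" "p + r > 0"
  shows "x powr r * beta_density p q x = Beta (p + r) q / Beta p q * beta_density (p + r) q x"
proof -
  have "x powr r * x powr (p - 1) = x powr (p + r - 1)"
    by (simp add: algebra_simps flip: powr_add)
  moreover have "Beta p q \<noteq> 0" "Beta (p + r) q \<noteq> 0"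
    using Beta_real_pos[of p q] Beta_real_pos[of "p + r" q] assms by simp_all
  ultimately show ?thesis
    by (auto simp: beta_density_def)
qed

lemma has_bochner_integral_beta_density:
  assumes "p > 0" "q > 0"
  shows "has_bochner_integral lborel (beta_density p q) 1"
proof -
  have "((\<lambda>t. t powr (p - 1) * (1 - t) powr (q - 1) / Beta p q) has_integral Beta p q / Beta p q) {0..1}"
    using has_integral_Beta_real[OF assms] by (rule has_integral_divide)
  then have "((\<lambda>t. t powr (p - 1) * (1 - t) powr (q - 1) / Beta p q) has_integral 1) {0<..<1}"
    using Beta_real_pos[OF assms] by (simp add: has_integral_Icc_iff_Ioo)
  then have "((\<lambda>t. if t \<in> {0<..<1} then t powr (p - 1) * (1 - t) powr (q - 1) / Beta p q else 0) has_integral 1) UNIV"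
    by (subst has_integral_restrict_UNIV)
  then have "(beta_density p q has_integral 1) UNIV"
    by (rule has_integral_cong[THEN iffD1, rotated]) (auto simp: beta_density_def)
  then show ?thesis
    using has_bochner_integral_nn_integral[of "beta_density p q" lborel 1]
      nn_integral_has_integral_lborel[of "beta_density p q" 1] beta_density_nonneg[OF assms] by simp
qed

lemma integral_beta_moment:
  assumes "p > 0" "q > 0"
  shows "has_bochner_integral (density lborel (\<lambda>x. ennreal (beta_density p q x))) (\<lambda>x. x ^ k)
    (Beta (p + real k) q / Beta p q)"
proof -
  \<comment> \<open>Natural powers and \<open>powr\<close> agree for positive \<open>x\<close>;
    elsewhere the densities on both sides vanish.\<close>
  have "x ^ k * beta_density p q x = Beta (p + real k) q / Beta p q * beta_density (p + real k) q x" for x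
    using powr_mult_beta_density[OF assms, of "real k" x] assms
    by (cases "0 < x") (auto simp: beta_density_def powr_realpow)
  moreover have "has_bochner_integral lborel
      (\<lambda>x. Beta (p + real k) q / Beta p q * beta_density (p + real k) q x) (Beta (p + real k) q / Beta p q * 1)"
    using assms by (intro has_bochner_integral_mult_right has_bochner_integral_beta_density) auto
  ultimately have "has_bochner_integral lborel (\<lambda>x. beta_density p q x *\<^sub>R x ^ k) (Beta (p + real k) q / Beta p q)"
    by (simp add: mult.commute)
  then show ?thesis
    using beta_density_nonneg[OF assms]
    by (intro has_bochner_integral_density) auto
qed

section \<open>Moments of the coordinates of a uniform point\<close>

lemma coeff_1_plus_square_power:
  "coeff ([:1, 0, 1:] ^ k :: real poly) 0 = 1" "coeff ([:1, 0, 1:] ^ k :: real poly) 2 = real k"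
proof -
  have "coeff ([:1, 0, 1:] ^ k :: real poly) 0 = 1 \<and> coeff ([:1, 0, 1:] ^ k :: real poly) 2 = real k"
    by (induction k) (simp_all add: numeral_2_eq_2)
  then show "coeff ([:1, 0, 1:] ^ k :: real poly) 0 = 1" "coeff ([:1, 0, 1:] ^ k :: real poly) 2 = real k"
    by auto
qed

locale spherical =
  fixes \<mu> :: "(real^'n) measure"
  assumes \<mu>: "refl_uniform UNIV \<mu>"
begin

sublocale prob_space \<mu> by (rule refl_uniformD(1)[OF \<mu>])

lemma sets_sphere [measurable_cong, simp]: "sets \<mu> = sets borel"
  by (rule refl_uniformD(2)[OF \<mu>])

lemma AE_sphere: "AE x in \<mu>. norm x = 1"
  using refl_uniformD(3)[OF \<mu>] by simp

lemma integrable_sphere: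
  fixes f :: "real^'n \<Rightarrow> real"
  assumes "f \<in> borel_measurable borel" "\<And>x. norm x = 1 \<Longrightarrow> \<bar>f x\<bar> \<le> C"
  shows "integrable \<mu> f"
proof (rule integrable_const_bound)
  show "AE x in \<mu>. norm (f x) \<le> C"
    using AE_sphere by eventually_elim (use assms in auto)
  show "f \<in> borel_measurable \<mu>" using assms by measurable
qed

lemma integrable_sphere_powers: "integrable \<mu> (\<lambda>z. (z $ i) ^ k * (z $ j) ^ l)"
proof (rule integrable_sphere)
  fix z :: "real^'n" assume "norm z = 1"
  then have "\<bar>z $ i\<bar> \<le> 1" "\<bar>z $ j\<bar> \<le> 1"
    by (metis component_le_norm_cart)+
  then have "\<bar>z $ i\<bar> ^ k * \<bar>z $ j\<bar> ^ l \<le> 1"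
    by (intro mult_le_one power_le_one) auto
  then show "\<bar>(z $ i) ^ k * (z $ j) ^ l\<bar> \<le> 1"
    by (simp add: abs_mult power_abs)
qed measurable

text \<open>
  By invariance, \<open>E ((\<eta>\<^sub>i + s \<eta>\<^sub>j) ^ (2 k)) = (1 + s\<^sup>2) ^ k * E (\<eta>\<^sub>i ^ (2 k))\<close>; compare the
  coefficients of \<open>s\<^sup>2\<close>.
\<close>
lemma sphere_mixed_moment:
  assumes "i \<noteq> j"
  shows "real (2 * k + 1) * (\<integral>z. (z $ i) ^ (2 * k) * (z $ j)\<^sup>2 \<partial>\<mu>) = (\<integral>z. (z $ i) ^ (2 * k + 2) \<partial>\<mu>)"
proof -
  \<comment> \<open>With exponent \<open>2 * K = 2 * k + 2\<close>, the coefficient of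
    \<open>s\<^sup>2\<close> is a multiple of the mixed moment in question.\<close>
  define K where "K = Suc k"
  define m where "m = (\<integral>z. (z $ i) ^ (2 * K) \<partial>\<mu>)"
  define c where "c l = real (2 * K choose l) * (\<integral>z. (z $ i) ^ (2 * K - l) * (z $ j) ^ l \<partial>\<mu>)" for l
  have "poly (\<Sum>l\<le>2 * K. monom (c l) l) s = poly (smult m ([:1, 0, 1:] ^ K)) s" for s
  proof -
    have "poly (\<Sum>l\<le>2 * K. monom (c l) l) s = (\<Sum>l\<le>2 * K. c l * s ^ l)"
      by (simp add: poly_sum poly_monom)
    also have "\<dots> = (\<integral>z. (\<Sum>l\<le>2 * K. real (2 * K choose l) * s ^ l * ((z $ i) ^ (2 * K - l) * (z $ j) ^ l)) \<partial>\<mu>)"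
      by (subst Bochner_Integration.integral_sum)
        (simp_all add: c_def integrable_sphere_powers mult.assoc mult.left_commute mult.commute[of _ "s ^ _"])
    also have "\<dots> = (\<integral>z. (s * z $ j + z $ i) ^ (2 * K) \<partial>\<mu>)"
      by (simp add: binomial_ring power_mult_distrib mult_ac)
    also have "\<dots> = (\<integral>z. ((s *\<^sub>R axis j 1 + axis i 1) \<bullet> z) ^ (2 * K) \<partial>\<mu>)"
      by (simp add: inner_add_left inner_axis')
    \<comment> \<open>Both directions have norm \<open>sqrt (1 + s\<^sup>2)\<close>, so invariance
      allows one to replace the other.\<close>
    also have "\<dots> = (\<integral>z. ((sqrt (1 + s\<^sup>2) *\<^sub>R axis i 1) \<bullet> z) ^ (2 * K) \<partial>\<mu>)"
    proof (rule refl_uniform_integral_inner[OF \<mu>])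
      have "(norm (s *\<^sub>R axis j 1 + axis i 1 :: real^'n))\<^sup>2 = 1 + s\<^sup>2"
        using assms unfolding power2_norm_eq_inner
        by (simp add: inner_add_left inner_add_right inner_axis_axis power2_eq_square)
      then have "norm (s *\<^sub>R axis j 1 + axis i 1 :: real^'n) = sqrt (1 + s\<^sup>2)"
        by (metis norm_ge_zero real_sqrt_unique)
      then show "norm (s *\<^sub>R axis j 1 + axis i 1 :: real^'n) = norm (sqrt (1 + s\<^sup>2) *\<^sub>R axis i 1 :: real^'n)"
        by simp
    qed auto
    also have "\<dots> = (1 + s\<^sup>2) ^ K * m"
      by (simp add: m_def inner_axis' power_mult_distrib power_mult)
    also have "\<dots> = poly (smult m ([:1, 0, 1:] ^ K)) s"
      by (simp add: poly_power power2_eq_square algebra_simps)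
    finally show ?thesis .
  qed
  then have "(\<Sum>l\<le>2 * K. monom (c l) l) = smult m ([:1, 0, 1:] ^ K)"
    by (simp add: poly_eq_poly_eq_iff[symmetric] fun_eq_iff)
  then have "coeff (\<Sum>l\<le>2 * K. monom (c l) l) 2 = coeff (smult m ([:1, 0, 1:] ^ K)) 2"
    by simp
  moreover have "coeff (\<Sum>l\<le>2 * K. monom (c l) l) 2 = c 2"
    by (simp add: coeff_sum) (simp add: K_def)
  ultimately have "c 2 = m * real K"
    by (simp add: coeff_1_plus_square_power)
  \<comment> \<open>The factor \<open>K\<close> cancels against the coefficient \<open>K\<close> of
    \<open>s\<^sup>2\<close> in \<open>(1 + s\<^sup>2) ^ K\<close>.\<close>
  moreover have "real (2 * K choose 2) = real (2 * k + 1) * real K"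
    by (simp add: choose_two K_def algebra_simps)
  ultimately have "real (2 * k + 1) * (\<integral>z. (z $ i) ^ (2 * K - 2) * (z $ j)\<^sup>2 \<partial>\<mu>) * real K = m * real K"
    by (simp add: c_def)
  then show ?thesis
    by (simp add: K_def m_def)
qed

text \<open>Insert the sum of the squared coordinates, which is 1 on the sphere. The term
  \<open>j = i\<close> raises the exponent by 2, and each of the other \<open>CARD('n) - 1\<close>
  terms is a mixed moment.\<close>

lemma sphere_moment_rec:
  "(real (2 * k) + real CARD('n)) * (\<integral>z. (z $ i) ^ (2 * k + 2) \<partial>\<mu>) = real (2 * k + 1) * (\<integral>z. (z $ i) ^ (2 * k) \<partial>\<mu>)"
proof -
  have "(\<integral>z. (z $ i) ^ (2 * k) \<partial>\<mu>) = (\<integral>z. (\<Sum>j\<in>UNIV. (z $ i) ^ (2 * k) * (z $ j)\<^sup>2) \<partial>\<mu>)"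
  proof (rule integral_cong_AE)
    show "AE z in \<mu>. (z $ i) ^ (2 * k) = (\<Sum>j\<in>UNIV. (z $ i) ^ (2 * k) * (z $ j)\<^sup>2)"
      using AE_sphere
    proof eventually_elim
      case (elim z)
      have "(\<Sum>j\<in>UNIV. (z $ j)\<^sup>2) = (norm z)\<^sup>2"
        by (simp add: norm_vec_def L2_set_def sum_nonneg)
      then show ?case
        using elim by (simp flip: sum_distrib_left)
    qed
  qed measurable
  also have "\<dots> = (\<Sum>j\<in>UNIV. \<integral>z. (z $ i) ^ (2 * k) * (z $ j)\<^sup>2 \<partial>\<mu>)"
    by (intro Bochner_Integration.integral_sum integrable_sphere_powers)
  finally have "real (2 * k + 1) * (\<integral>z. (z $ i) ^ (2 * k) \<partial>\<mu>) =
      (\<Sum>j\<in>UNIV. real (2 * k + 1) * (\<integral>z. (z $ i) ^ (2 * k) * (z $ j)\<^sup>2 \<partial>\<mu>))"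
    by (simp add: sum_distrib_left)
  also have "\<dots> = real (2 * k + 1) * (\<integral>z. (z $ i) ^ (2 * k) * (z $ i)\<^sup>2 \<partial>\<mu>) +
      (\<Sum>j\<in>UNIV - {i}. real (2 * k + 1) * (\<integral>z. (z $ i) ^ (2 * k) * (z $ j)\<^sup>2 \<partial>\<mu>))"
    by (rule sum.remove) auto
  also have "(\<Sum>j\<in>UNIV - {i}. real (2 * k + 1) * (\<integral>z. (z $ i) ^ (2 * k) * (z $ j)\<^sup>2 \<partial>\<mu>)) =
      (\<Sum>j\<in>UNIV - {i}. (\<integral>z. (z $ i) ^ (2 * k + 2) \<partial>\<mu>))"
    by (intro sum.cong sphere_mixed_moment) auto
  also have "\<dots> = (real CARD('n) - 1) * (\<integral>z. (z $ i) ^ (2 * k + 2) \<partial>\<mu>)"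
    by (simp add: of_nat_diff Suc_leI)
  finally show ?thesis
    by (simp add: algebra_simps flip: power_add)
qed

text \<open>The Beta quotients obey the same recursion as the moments, and both sequences start at
  1.\<close>

lemma sphere_moment:
  assumes "CARD('n) \<ge> 2"
  shows "(\<integral>z. ((z $ i)\<^sup>2) ^ k \<partial>\<mu>) = Beta (1/2 + real k) ((real CARD('n) - 1) / 2) / Beta (1/2) ((real CARD('n) - 1) / 2)"
    (is "_ = Beta (_ + _) ?q / _")
proof (induction k)
  case 0
  have "Beta (1/2) ?q > 0" by (rule Beta_real_pos) (use assms in auto)
  then show ?case by (simp add: prob_space)
next
  case (Suc k)
  have "(1/2 + real k + ?q) * Beta (1/2 + real k + 1) ?q = (1/2 + real k) * Beta (1/2 + real k) ?q"
    using assms by (intro Beta_plus1_left) (auto simp: nonpos_Ints_def)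
  then have B: "(real (2 * k) + real CARD('n)) * Beta (1/2 + real (Suc k)) ?q = real (2 * k + 1) * Beta (1/2 + real k) ?q"
    by (simp add: field_simps)
  have "(real (2 * k) + real CARD('n)) * (\<integral>z. ((z $ i)\<^sup>2) ^ Suc k \<partial>\<mu>) = real (2 * k + 1) * (\<integral>z. ((z $ i)\<^sup>2) ^ k \<partial>\<mu>)"
    using sphere_moment_rec[of k i] by (simp flip: power_mult power_add)
  also have "\<dots> = (real (2 * k) + real CARD('n)) * (Beta (1/2 + real (Suc k)) ?q / Beta (1/2) ?q)"
    unfolding Suc using B by simp
  finally show ?case
    by (rule mult_left_cancel[THEN iffD1, rotated]) (use assms in linarith)
qed

text \<open>Laws on \<open>{0..1}\<close> are determined by their moments, since polynomials are
  uniformly dense there. Invariance allows \<open>u\<close> to be replaced by a coordinate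
  vector.\<close>

lemma sphere_inner_square_distr:
  assumes n: "CARD('n) \<ge> 2" and u: "norm u = 1"
  shows "distr \<mu> borel (\<lambda>z. (u \<bullet> z)\<^sup>2) =
    density lborel (\<lambda>x. ennreal (beta_density (1/2) ((real CARD('n) - 1) / 2) x))" (is "?D = ?E")
proof (rule measure_eqI_function_ring[where K = "{0..1}" and R = "Collect real_polynomial_function"])
  have q: "(real CARD('n) - 1) / 2 > 0" using n by simp
  interpret D: prob_space ?D by (rule prob_space_distr) measurable
  show "finite_measure ?D" by (rule D.finite_measure_axioms)
  show "finite_measure ?E"
    using has_bochner_integral_beta_density[OF _ q, of "1/2"] beta_density_nonneg[OF _ q, of "1/2"]
    by (intro finite_measureI)
      (auto simp: emeasure_density has_bochner_integral_iff nn_integral_eq_integral)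
  show "AE x in ?D. x \<in> {0..1}"
  proof (subst AE_distr_iff)
    show "AE z in \<mu>. (u \<bullet> z)\<^sup>2 \<in> {0..1}"
      using AE_sphere
    proof eventually_elim
      case (elim z)
      then show ?case
        using Cauchy_Schwarz_ineq2[of u z] u by (simp add: abs_square_le_1)
    qed
  qed measurable
  show "AE x in ?E. x \<in> {0..1}"
    by (subst AE_density) (auto simp: beta_density_def)
  show "function_ring_on (Collect real_polynomial_function) {0..1::real}"
  proof
    fix x y :: real assume "x \<noteq> y"
    then show "\<exists>f\<in>Collect real_polynomial_function. f x \<noteq> f y"
      using real_polynomial_function_separable by auto
  qed (auto simp: continuous_on_polymonial_function real_polynomial_function_eq
      intro: polynomial_function_mult[where 'b = real, unfolded real_scaleR_def])
  show "f \<in> borel_measurable borel" if "f \<in> Collect real_polynomial_function" for f :: "real \<Rightarrow> real"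
    using that by (intro borel_measurable_continuous_onI continuous_on_polymonial_function)
      (auto simp: real_polynomial_function_eq)
  fix f :: "real \<Rightarrow> real" assume "f \<in> Collect real_polynomial_function"
  then obtain a k where f: "f = (\<lambda>x. \<Sum>l\<le>k. a l * x ^ l)"
    by (auto simp: real_polynomial_function_iff_sum)
  fix i :: 'n
  have "integral\<^sup>L ?D f = (\<integral>z. (\<Sum>l\<le>k. a l * ((u \<bullet> z)\<^sup>2) ^ l) \<partial>\<mu>)"
    unfolding f by (rule integral_distr) measurable
  also have "\<dots> = (\<integral>z. (\<Sum>l\<le>k. a l * ((axis i 1 \<bullet> z)\<^sup>2) ^ l) \<partial>\<mu>)"
    by (rule refl_uniform_integral_inner[OF \<mu>]) (use u in auto)
  also have "\<dots> = (\<Sum>l\<le>k. a l * (\<integral>z. ((z $ i)\<^sup>2) ^ l \<partial>\<mu>))"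
    using integrable_sphere_powers[of i _ i 0]
    by (subst Bochner_Integration.integral_sum) (auto simp: inner_axis' simp flip: power_mult)
  also have "\<dots> = integral\<^sup>L ?E f"
    unfolding f using integral_beta_moment[OF _ q, of "1/2"]
    by (subst Bochner_Integration.integral_sum)
      (auto simp: sphere_moment[OF n] has_bochner_integral_iff)
  finally show "integral\<^sup>L ?D f = integral\<^sup>L ?E f" .
qed auto

end

section \<open>Polar decomposition\<close>

lemma indep_rvs_distr_pair:
  fixes X :: "'a \<Rightarrow> 'b::topological_space" and Y :: "'a \<Rightarrow> 'c::topological_space"
  assumes "prob_space P" and ind: "indep_rvs P X Y"
  shows "distr P (borel \<Otimes>\<^sub>M borel) (\<lambda>\<omega>. (X \<omega>, Y \<omega>)) = distr P borel X \<Otimes>\<^sub>M distr P borel Y"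
proof (rule pair_measure_eqI[symmetric])
  interpret prob_space P by fact
  have [measurable]: "X \<in> borel_measurable P" "Y \<in> borel_measurable P"
    using ind by (auto simp: indep_rvs_def)
  interpret X: prob_space "distr P borel X" by (rule prob_space_distr) measurable
  interpret Y: prob_space "distr P borel Y" by (rule prob_space_distr) measurable
  show "sigma_finite_measure (distr P borel X)" "sigma_finite_measure (distr P borel Y)" ..
  fix A B assume "A \<in> sets (distr P borel X)" "B \<in> sets (distr P borel Y)"
  then have [measurable]: "A \<in> sets borel" "B \<in> sets borel" by auto
  have "prob ((X -` A \<inter> space P) \<inter> (Y -` B \<inter> space P)) = prob (X -` A \<inter> space P) * prob (Y -` B \<inter> space P)"
    using ind by (intro indep_setD) (auto simp: indep_rvs_def)
  moreover have "(X -` A \<inter> space P) \<inter> (Y -` B \<inter> space P) = (\<lambda>\<omega>. (X \<omega>, Y \<omega>)) -` (A \<times> B) \<inter> space P"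
    by auto
  ultimately show "emeasure (distr P borel X) A * emeasure (distr P borel Y) B =
      emeasure (distr P (borel \<Otimes>\<^sub>M borel) (\<lambda>\<omega>. (X \<omega>, Y \<omega>))) (A \<times> B)"
    by (simp add: emeasure_distr emeasure_eq_measure ennreal_mult)
qed (simp cong: sets_pair_measure_cong)

text \<open>If the part of \<open>z\<close> orthogonal to \<open>u\<close> vanishes,
  \<open>inverse 0 = 0\<close> makes the value the zero vector rather than a unit vector.\<close>

definition normal_dir :: "real^'n \<Rightarrow> real^'n \<Rightarrow> real^'n" where
  "normal_dir u z = inverse (norm (z - (u \<bullet> z) *\<^sub>R u)) *\<^sub>R (z - (u \<bullet> z) *\<^sub>R u)"

lemma borel_measurable_normal_dir [measurable]: "normal_dir u \<in> borel_measurable borel"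
  unfolding normal_dir_def by measurable

lemma normal_dir_orthogonal: "norm u = 1 \<Longrightarrow> normal_dir u z \<bullet> u = 0"
  by (simp add: normal_dir_def inner_diff_left norm_eq_1) (simp add: inner_commute)

lemma norm_normal_part:
  assumes "norm u = 1" "norm z = 1"
  shows "(norm (z - (u \<bullet> z) *\<^sub>R u))\<^sup>2 = 1 - (u \<bullet> z)\<^sup>2"
  using assms unfolding power2_norm_eq_inner
  by (simp add: inner_diff_left inner_diff_right inner_commute norm_eq_1 power2_eq_square)

lemma norm_normal_dir:
  assumes "norm u = 1" "norm z = 1" "(u \<bullet> z)\<^sup>2 \<noteq> 1"
  shows "norm (normal_dir u z) = 1"
  using norm_normal_part[OF assms(1,2)] assms(3)
  by (cases "z - (u \<bullet> z) *\<^sub>R u = 0") (simp_all add: normal_dir_def)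

text \<open>The square root is the length of the orthogonal part; where this part vanishes, so does
  the last summand.\<close>

lemma normal_dir_decomposition:
  assumes "norm u = 1" "norm z = 1"
  shows "z = (u \<bullet> z) *\<^sub>R u + sqrt (1 - (u \<bullet> z)\<^sup>2) *\<^sub>R normal_dir u z"
proof -
  have "sqrt (1 - (u \<bullet> z)\<^sup>2) = norm (z - (u \<bullet> z) *\<^sub>R u)"
    by (metis norm_normal_part[OF assms] norm_ge_zero real_sqrt_unique)
  then show ?thesis
    by (cases "z - (u \<bullet> z) *\<^sub>R u = 0") (simp_all add: normal_dir_def)
qed

text \<open>A reflection along a vector orthogonal to \<open>u\<close> fixes \<open>u\<close>, so it
  commutes with removing the component along \<open>u\<close>.\<close>

lemma normal_dir_refl_along:
  assumes "d \<bullet> u = 0"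
  shows "normal_dir u (refl_along d z) = refl_along d (normal_dir u z)"
proof -
  have u: "refl_along d u = u"
    using assms by (intro refl_along_orthogonal) (simp add: inner_commute)
  then have "u \<bullet> refl_along d z = u \<bullet> z"
    using refl_along_inner[of d u z] by simp
  then have "refl_along d z - (u \<bullet> refl_along d z) *\<^sub>R u = refl_along d (z - (u \<bullet> z) *\<^sub>R u)"
    by (simp add: linear_diff[OF linear_refl_along] linear_cmul[OF linear_refl_along] u)
  then show ?thesis
    by (simp add: normal_dir_def linear_cmul[OF linear_refl_along])
qed

lemma subspace_orthogonal_vector: "subspace {v::'a::real_inner. v \<bullet> u = 0}"
  by (auto simp: subspace_def inner_add_left)

locale spherical_axis = spherical \<mu> for \<mu> :: "(real^'n) measure" +
  fixes u :: "real^'n"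
  assumes n: "CARD('n) \<ge> 2" and u: "norm u = 1"
begin

lemma space_sphere [simp]: "space \<mu> = UNIV"
  using sets_eq_imp_space_eq[OF sets_sphere] by simp

text \<open>The squared component has a density. The value 1 excludes the points parallel to
  \<open>u\<close>, and the value 0 later excludes ties between two points of
  \<open>M\<close>.\<close>

lemma AE_inner_square_neq: "AE z in \<mu>. (u \<bullet> z)\<^sup>2 \<noteq> c"
proof -
  have "AE x in distr \<mu> borel (\<lambda>z. (u \<bullet> z)\<^sup>2). x \<noteq> c"
    unfolding sphere_inner_square_distr[OF n u]
    using AE_lborel_singleton[of c] by (subst AE_density) (auto elim: eventually_mono)
  then show ?thesis
    by (subst (asm) AE_distr_iff) measurable
qed

lemma AE_norm_normal_dir: "AE z in \<mu>. norm (normal_dir u z) = 1"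
  using AE_inner_square_neq[of 1] AE_sphere
  by eventually_elim (use u norm_normal_dir in blast)

text \<open>The conditioning event depends on \<open>z\<close> only through
  \<open>u \<bullet> z\<close>. Reflections along vectors orthogonal to \<open>u\<close> preserve it
  and \<mu>, hence the conditional measure, and they commute with
  \<open>normal_dir u\<close>.\<close>

lemma refl_uniform_conditional_normal_dir:
  assumes [measurable]: "A \<in> sets borel" and pos: "emeasure \<mu> {z. (u \<bullet> z)\<^sup>2 \<in> A} \<noteq> 0"
  shows "refl_uniform {v. v \<bullet> u = 0} (distr (uniform_measure \<mu> {z. (u \<bullet> z)\<^sup>2 \<in> A}) borel (normal_dir u))"
proof -
  define E where "E = {z. (u \<bullet> z)\<^sup>2 \<in> A}"
  have E [measurable]: "E \<in> sets borel"
    unfolding E_def by measurable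
  define \<kappa> where "\<kappa> = uniform_measure \<mu> E"
  have [measurable_cong, simp]: "sets \<kappa> = sets borel" by (simp add: \<kappa>_def)
  interpret \<kappa>: prob_space \<kappa>
    unfolding \<kappa>_def using pos by (intro prob_space_uniform_measure) (auto simp: E_def emeasure_eq_measure)
  show ?thesis
    unfolding refl_uniform_def E_def[symmetric] \<kappa>_def[symmetric]
  proof (intro conjI ballI)
    show "prob_space (distr \<kappa> borel (normal_dir u))"
      by (rule \<kappa>.prob_space_distr) measurable
    have "AE z in \<kappa>. norm (normal_dir u z) = 1"
      unfolding \<kappa>_def using AE_norm_normal_dir by (intro AE_uniform_measureI) auto
    then show "AE x in distr \<kappa> borel (normal_dir u). x \<in> {v. v \<bullet> u = 0} \<and> norm x = 1"
      by (subst AE_distr_iff) (auto simp: normal_dir_orthogonal[OF u])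
    fix d assume "d \<in> {v. v \<bullet> u = 0}"
    then have d: "d \<bullet> u = 0" by simp
    have inner: "u \<bullet> refl_along d z = u \<bullet> z" for z
      using d refl_along_inner[of d u z] refl_along_orthogonal[of u d] by (simp add: inner_commute)
    have "distr \<kappa> borel (refl_along d) = \<kappa>"
    proof (rule measure_eqI)
      fix C assume "C \<in> sets (distr \<kappa> borel (refl_along d))"
      then have [measurable]: "C \<in> sets borel" by simp
      have "emeasure \<mu> (E \<inter> refl_along d -` C) = emeasure \<mu> (refl_along d -` (E \<inter> C) \<inter> space \<mu>)"
        by (rule arg_cong[where f = "emeasure \<mu>"]) (auto simp: E_def inner)
      also have "\<dots> = emeasure (distr \<mu> borel (refl_along d)) (E \<inter> C)"
        by (rule emeasure_distr[symmetric]) measurable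
      also have "\<dots> = emeasure \<mu> (E \<inter> C)"
        by (simp add: refl_uniformD(4)[OF \<mu>])
      finally have "emeasure \<mu> (E \<inter> refl_along d -` C) = emeasure \<mu> (E \<inter> C)" .
      then show "emeasure (distr \<kappa> borel (refl_along d)) C = emeasure \<kappa> C"
        using measurable_sets[OF borel_measurable_refl_along \<open>C \<in> sets borel\<close>, of d]
        by (simp add: emeasure_distr \<kappa>_def)
    qed simp
    then have "distr \<kappa> borel (normal_dir u) = distr (distr \<kappa> borel (refl_along d)) borel (normal_dir u)"
      by simp
    also have "\<dots> = distr \<kappa> borel (normal_dir u \<circ> refl_along d)"
      by (rule distr_distr) measurable
    also have "normal_dir u \<circ> refl_along d = refl_along d \<circ> normal_dir u"
      using d by (auto simp: normal_dir_refl_along)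
    also have "distr \<kappa> borel (refl_along d \<circ> normal_dir u) = distr (distr \<kappa> borel (normal_dir u)) borel (refl_along d)"
      by (rule distr_distr[symmetric]) measurable
    finally show "distr (distr \<kappa> borel (normal_dir u)) borel (refl_along d) = distr \<kappa> borel (normal_dir u)" ..
  qed simp
qed

text \<open>By uniqueness, the conditional law of the direction given any event of positive mass in
  the squared component is \<sigma>, whatever the event. This is independence on rectangles.\<close>

lemma sphere_polar_distr:
  assumes \<sigma>: "refl_uniform {v. v \<bullet> u = 0} \<sigma>"
  shows "distr \<mu> (borel \<Otimes>\<^sub>M borel) (\<lambda>z. ((u \<bullet> z)\<^sup>2, normal_dir u z)) = distr \<mu> borel (\<lambda>z. (u \<bullet> z)\<^sup>2) \<Otimes>\<^sub>M \<sigma>"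
proof (rule pair_measure_eqI[symmetric])
  interpret \<sigma>: prob_space \<sigma> by (rule refl_uniformD(1)[OF \<sigma>])
  interpret D: prob_space "distr \<mu> borel (\<lambda>z. (u \<bullet> z)\<^sup>2)" by (rule prob_space_distr) measurable
  show "sigma_finite_measure \<sigma>" "sigma_finite_measure (distr \<mu> borel (\<lambda>z. (u \<bullet> z)\<^sup>2))" ..
  have [simp]: "sets \<sigma> = sets borel" by (rule refl_uniformD(2)[OF \<sigma>])
  show "sets (distr \<mu> borel (\<lambda>z. (u \<bullet> z)\<^sup>2) \<Otimes>\<^sub>M \<sigma>) = sets (distr \<mu> (borel \<Otimes>\<^sub>M borel) (\<lambda>z. ((u \<bullet> z)\<^sup>2, normal_dir u z)))"
    by (simp cong: sets_pair_measure_cong)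
  fix A C assume "A \<in> sets (distr \<mu> borel (\<lambda>z. (u \<bullet> z)\<^sup>2))" "C \<in> sets \<sigma>"
  then have [measurable]: "A \<in> sets borel" "C \<in> sets borel" by auto
  define E where "E = {z. (u \<bullet> z)\<^sup>2 \<in> A}"
  have E [measurable]: "E \<in> sets borel"
    unfolding E_def by measurable
  have *: "emeasure \<mu> E * emeasure \<sigma> C = emeasure \<mu> (E \<inter> normal_dir u -` C)"
  \<comment> \<open>Conditioning requires positive mass; for a null event both sides are 0.\<close>
  proof (cases "emeasure \<mu> E = 0")
    case True
    then have "emeasure \<mu> (E \<inter> normal_dir u -` C) = 0"
      by (intro emeasure_eq_0[OF _ True]) auto
    then show ?thesis using True by simp
  next
    case False
    have "\<sigma> = distr (uniform_measure \<mu> E) borel (normal_dir u)"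
      using refl_uniform_unique[OF \<sigma> refl_uniform_conditional_normal_dir[OF \<open>A \<in> sets borel\<close>] subspace_orthogonal_vector]
        False by (simp add: E_def)
    then have "emeasure \<sigma> C = emeasure \<mu> (E \<inter> normal_dir u -` C) / emeasure \<mu> E"
      using measurable_sets[OF borel_measurable_normal_dir \<open>C \<in> sets borel\<close>, of u]
      by (simp add: emeasure_distr)
    then show ?thesis
      using False by (simp add: emeasure_eq_measure divide_ennreal zero_less_measure_iff flip: ennreal_mult)
  qed
  have "(\<lambda>z. ((u \<bullet> z)\<^sup>2, normal_dir u z)) -` (A \<times> C) \<inter> space \<mu> = E \<inter> normal_dir u -` C"
    "(\<lambda>z. (u \<bullet> z)\<^sup>2) -` A \<inter> space \<mu> = E"
    by (auto simp: E_def)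
  then show "emeasure (distr \<mu> borel (\<lambda>z. (u \<bullet> z)\<^sup>2)) A * emeasure \<sigma> C =
      emeasure (distr \<mu> (borel \<Otimes>\<^sub>M borel) (\<lambda>z. ((u \<bullet> z)\<^sup>2, normal_dir u z))) (A \<times> C)"
    using * by (simp add: emeasure_distr)
qed

text \<open>The reflection along \<open>u\<close> reverses the sign of \<open>u \<bullet> z\<close>
  and keeps both its square and the normal direction.\<close>

lemma nn_integral_sphere_flip:
  assumes [measurable]: "g \<in> borel_measurable borel"
  shows "(\<integral>\<^sup>+z. ennreal ((max 0 (- (u \<bullet> z))) powr a) * indicator {z. g (normal_dir u z) \<le> (u \<bullet> z)\<^sup>2} z \<partial>\<mu>) =
    (\<integral>\<^sup>+z. ennreal ((max 0 (u \<bullet> z)) powr a) * indicator {z. g (normal_dir u z) \<le> (u \<bullet> z)\<^sup>2} z \<partial>\<mu>)"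
    (is "?l = ?r")
proof -
  have uu: "u \<bullet> u = 1" using u by (simp add: norm_eq_1)
  have inner: "u \<bullet> refl_along u z = - (u \<bullet> z)" for z
    using uu by (simp add: refl_along_def inner_diff_right inner_commute)
  have dir: "normal_dir u (refl_along u z) = normal_dir u z" for z
  proof -
    have "refl_along u z - (u \<bullet> refl_along u z) *\<^sub>R u = z - (u \<bullet> z) *\<^sub>R u"
      unfolding inner using uu by (simp add: refl_along_def inner_commute algebra_simps flip: scaleR_add_left)
    then show ?thesis by (simp add: normal_dir_def)
  qed
  have "?r = (\<integral>\<^sup>+z. ennreal ((max 0 (u \<bullet> z)) powr a) * indicator {z. g (normal_dir u z) \<le> (u \<bullet> z)\<^sup>2} z \<partial>distr \<mu> borel (refl_along u))"
    by (simp add: refl_uniformD(4)[OF \<mu>])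
  also have "\<dots> = (\<integral>\<^sup>+z. ennreal ((max 0 (u \<bullet> refl_along u z)) powr a) *
      indicator {z. g (normal_dir u z) \<le> (u \<bullet> z)\<^sup>2} (refl_along u z) \<partial>\<mu>)"
    by (rule nn_integral_distr) measurable
  also have "\<dots> = ?l"
    by (intro nn_integral_cong) (simp add: inner dir indicator_def)
  finally show ?thesis ..
qed

text \<open>
  The square \<open>b\<close> of the component along \<open>u\<close> has density \<open>beta_density (1/2) q\<close>; weighting it by
  \<open>b powr \<gamma>\<close> turns this density into a multiple of \<open>beta_density (\<gamma> + 1/2) q\<close>.
\<close>
lemma nn_integral_sphere_cap:
  fixes Q :: "'b measure" and B :: "'b \<Rightarrow> real" and V :: "'b \<Rightarrow> real^'n" and \<gamma> :: real
  defines "q \<equiv> (real CARD('n) - 1) / 2"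
  assumes Q: "prob_space Q" and \<gamma>: "\<gamma> > 0"
    and B: "distributed Q lborel B (\<lambda>x. ennreal (beta_density (\<gamma> + 1/2) q x))"
    and ind: "indep_rvs Q B V" and V: "refl_uniform {v. v \<bullet> u = 0} (distr Q borel V)"
    and [measurable]: "g \<in> borel_measurable borel"
  shows "2 * (\<integral>\<^sup>+z. ennreal ((max 0 (u \<bullet> z)) powr (2 * \<gamma>)) * indicator {z. g (normal_dir u z) \<le> (u \<bullet> z)\<^sup>2} z \<partial>\<mu>) =
    ennreal (Beta (\<gamma> + 1/2) q / Beta (1/2) q) * emeasure Q {\<omega>\<in>space Q. g (V \<omega>) \<le> B \<omega>}"
proof -
  define K where "K = Beta (\<gamma> + 1/2) q / Beta (1/2) q"
  define \<sigma> where "\<sigma> = distr Q borel V"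
  define D where "D p = density lborel (\<lambda>x. ennreal (beta_density p q x))" for p
  have q: "q > 0" using n by (simp add: q_def)
  have [measurable]: "B \<in> borel_measurable Q" "V \<in> borel_measurable Q"
    using ind by (auto simp: indep_rvs_def)
  have [measurable_cong, simp]: "sets \<sigma> = sets borel" "sets (D p) = sets borel" for p
    by (auto simp: \<sigma>_def D_def)
  interpret \<sigma>: prob_space \<sigma>
    using refl_uniformD(1)[OF V] by (simp add: \<sigma>_def)
  have K: "K \<ge> 0"
    using Beta_real_pos[of "\<gamma> + 1/2" q] Beta_real_pos[of "1/2" q] \<gamma> q by (simp add: K_def)
  have BD: "distr Q borel B = D (\<gamma> + 1/2)"
  proof -
    have "distr Q borel B = distr Q lborel B"
      by (rule distr_cong) auto
    also have "\<dots> = D (\<gamma> + 1/2)"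
      using B by (simp add: distributed_def D_def)
    finally show ?thesis .
  qed
  define \<psi> where "\<psi> = (\<lambda>(x, w). ennreal (x powr \<gamma>) * indicator {(x, w). g w \<le> x} (x :: real, w))"
  have ind_meas [measurable]: "{(x :: real, w). g w \<le> x} \<in> sets (borel \<Otimes>\<^sub>M borel)"
  proof -
    have "{z \<in> space (borel \<Otimes>\<^sub>M borel). g (snd z) \<le> fst z} \<in> sets (borel \<Otimes>\<^sub>M borel)"
      by measurable
    moreover have "{z \<in> space (borel \<Otimes>\<^sub>M borel). g (snd z) \<le> fst z} = {(x :: real, w). g w \<le> x}"
      by (auto simp: space_pair_measure)
    ultimately show ?thesis by simp
  qed
  have [measurable]: "\<psi> \<in> borel_measurable (borel \<Otimes>\<^sub>M borel)"
    unfolding \<psi>_def by measurable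
  let ?F = "\<lambda>s z. ennreal ((max 0 (s * (u \<bullet> z))) powr (2 * \<gamma>)) * indicator {z. g (normal_dir u z) \<le> (u \<bullet> z)\<^sup>2} z"
  \<comment> \<open>The two half-spaces contribute equally, and together they replace the positive
    part by \<open>((u \<bullet> z)\<^sup>2) powr \<gamma>\<close>, a function of the squared
    component alone.\<close>
  have "2 * (\<integral>\<^sup>+z. ?F 1 z \<partial>\<mu>) = (\<integral>\<^sup>+z. ?F 1 z \<partial>\<mu>) + (\<integral>\<^sup>+z. ?F (-1) z \<partial>\<mu>)"
    using nn_integral_sphere_flip[of g "2 * \<gamma>"] by (simp flip: mult_2)
  also have "\<dots> = (\<integral>\<^sup>+z. ?F 1 z + ?F (-1) z \<partial>\<mu>)"
    by (rule nn_integral_add[symmetric]) measurable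
  also have "\<dots> = (\<integral>\<^sup>+z. \<psi> ((u \<bullet> z)\<^sup>2, normal_dir u z) \<partial>\<mu>)"
  proof (rule nn_integral_cong)
    fix z
    have "t powr (2 * \<gamma>) = (t\<^sup>2) powr \<gamma>" if "t \<ge> 0" for t :: real
      using that by (cases "t = 0") (simp_all add: powr_powr flip: powr_numeral)
    from this[of "\<bar>u \<bullet> z\<bar>"]
    have "max 0 (u \<bullet> z) powr (2 * \<gamma>) + max 0 (- (u \<bullet> z)) powr (2 * \<gamma>) = ((u \<bullet> z)\<^sup>2) powr \<gamma>"
      by (cases "u \<bullet> z \<ge> 0") (simp_all add: max_def)
    then show "?F 1 z + ?F (-1) z = \<psi> ((u \<bullet> z)\<^sup>2, normal_dir u z)"
      by (auto simp: \<psi>_def indicator_def simp flip: ennreal_plus)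
  qed
  also have "\<dots> = (\<integral>\<^sup>+z. \<psi> z \<partial>distr \<mu> (borel \<Otimes>\<^sub>M borel) (\<lambda>z. ((u \<bullet> z)\<^sup>2, normal_dir u z)))"
    by (rule nn_integral_distr[symmetric]) measurable
  also have "distr \<mu> (borel \<Otimes>\<^sub>M borel) (\<lambda>z. ((u \<bullet> z)\<^sup>2, normal_dir u z)) = D (1/2) \<Otimes>\<^sub>M \<sigma>"
    using sphere_polar_distr[OF V] sphere_inner_square_distr[OF n u] by (simp add: D_def q_def \<sigma>_def)
  also have "(\<integral>\<^sup>+z. \<psi> z \<partial>(D (1/2) \<Otimes>\<^sub>M \<sigma>)) = (\<integral>\<^sup>+x. (\<integral>\<^sup>+w. \<psi> (x, w) \<partial>\<sigma>) \<partial>D (1/2))"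
    by (rule \<sigma>.nn_integral_fst[symmetric]) measurable
  also have "\<dots> = (\<integral>\<^sup>+x. ennreal (beta_density (1/2) q x) * (\<integral>\<^sup>+w. \<psi> (x, w) \<partial>\<sigma>) \<partial>lborel)"
    unfolding D_def by (rule nn_integral_density) measurable
  also have "\<dots> = (\<integral>\<^sup>+x. ennreal K * (ennreal (beta_density (\<gamma> + 1/2) q x) *
      (\<integral>\<^sup>+w. indicator {(x, w). g w \<le> x} (x, w) \<partial>\<sigma>)) \<partial>lborel)"
  proof (rule nn_integral_cong)
    fix x :: real
    have "(\<integral>\<^sup>+w. \<psi> (x, w) \<partial>\<sigma>) = ennreal (x powr \<gamma>) * (\<integral>\<^sup>+w. indicator {(x, w). g w \<le> x} (x, w) \<partial>\<sigma>)"
      unfolding \<psi>_def prod.case by (rule nn_integral_cmult) measurable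
    moreover have "beta_density (1/2) q x * x powr \<gamma> = K * beta_density (\<gamma> + 1/2) q x"
      using powr_mult_beta_density[of "1/2" q \<gamma> x] \<gamma> q by (simp add: K_def add.commute mult.commute)
    ultimately show "ennreal (beta_density (1/2) q x) * (\<integral>\<^sup>+w. \<psi> (x, w) \<partial>\<sigma>) =
        ennreal K * (ennreal (beta_density (\<gamma> + 1/2) q x) * (\<integral>\<^sup>+w. indicator {(x, w). g w \<le> x} (x, w) \<partial>\<sigma>))"
      using K q \<gamma> beta_density_nonneg[of "1/2" q x] beta_density_nonneg[of "\<gamma> + 1/2" q x]
      by (simp add: ennreal_mult[symmetric] mult.assoc[symmetric])
  qed
  also have "\<dots> = ennreal K * (\<integral>\<^sup>+x. ennreal (beta_density (\<gamma> + 1/2) q x) *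
      (\<integral>\<^sup>+w. indicator {(x, w). g w \<le> x} (x, w) \<partial>\<sigma>) \<partial>lborel)"
    by (rule nn_integral_cmult) measurable
  also have "(\<integral>\<^sup>+x. ennreal (beta_density (\<gamma> + 1/2) q x) *
      (\<integral>\<^sup>+w. indicator {(x, w). g w \<le> x} (x, w) \<partial>\<sigma>) \<partial>lborel) =
      (\<integral>\<^sup>+x. (\<integral>\<^sup>+w. indicator {(x, w). g w \<le> x} (x, w) \<partial>\<sigma>) \<partial>D (\<gamma> + 1/2))"
    unfolding D_def by (rule nn_integral_density[symmetric]) measurable
  also have "\<dots> = (\<integral>\<^sup>+z. indicator {(x, w). g w \<le> x} z \<partial>(D (\<gamma> + 1/2) \<Otimes>\<^sub>M \<sigma>))"
    by (rule \<sigma>.nn_integral_fst) measurable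
  also have "D (\<gamma> + 1/2) \<Otimes>\<^sub>M \<sigma> = distr Q (borel \<Otimes>\<^sub>M borel) (\<lambda>\<omega>. (B \<omega>, V \<omega>))"
    using indep_rvs_distr_pair[OF Q ind] by (simp add: BD \<sigma>_def)
  also have "(\<integral>\<^sup>+z. indicator {(x, w). g w \<le> x} z \<partial>distr Q (borel \<Otimes>\<^sub>M borel) (\<lambda>\<omega>. (B \<omega>, V \<omega>))) =
      emeasure Q {\<omega>\<in>space Q. g (V \<omega>) \<le> B \<omega>}"
    by (subst nn_integral_indicator, use ind_meas in simp, subst emeasure_distr)
      (auto intro!: arg_cong[where f = "emeasure Q"])
  finally show ?thesis
    by (simp add: K_def)
qed

end

section \<open>Local critical radii and degenerate configurations\<close>

lemma continuous_on_Max_image: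
  fixes f :: "'i \<Rightarrow> 'a::topological_space \<Rightarrow> real"
  assumes "finite I" "I \<noteq> {}" "\<And>i. i \<in> I \<Longrightarrow> continuous_on S (f i)"
  shows "continuous_on S (\<lambda>x. MAX i\<in>I. f i x)"
  using assms
proof (induction rule: finite_ne_induct)
  case (insert i F)
  then have "continuous_on S (\<lambda>x. max (f i x) (MAX i\<in>F. f i x))"
    by (intro continuous_intros) auto
  then show ?case using insert by simp
qed auto

text \<open>Keeps the denominators \<open>1 - u \<bullet> w\<close> in \<open>max_cot\<close>
  positive.\<close>

lemma inner_less_1_if_unit:
  fixes u w :: "'a::real_inner"
  assumes "norm u = 1" "norm w = 1" "w \<noteq> u"
  shows "u \<bullet> w < 1"
proof -
  have "0 < (u - w) \<bullet> (u - w)"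
    using assms by simp
  also have "\<dots> = 2 - 2 * (u \<bullet> w)"
    using assms by (simp add: inner_diff_left inner_diff_right norm_eq_1) (simp add: inner_commute)
  finally show ?thesis by simp
qed

text \<open>The squared cosine of an angle is its squared cotangent divided by 1 plus that square;
  the cut-off at 0 accounts for the angle \<open>pi / 2\<close>. The closed form gives continuity in
  \<open>v\<close>, which the description operator in \<open>local_critical_radius\<close>
  hides.\<close>

definition cos2_radius :: "(real^'n) set \<Rightarrow> real^'n \<Rightarrow> real^'n \<Rightarrow> real" where
  "cos2_radius M u v = (max 0 (max_cot M u v))\<^sup>2 / (1 + (max 0 (max_cot M u v))\<^sup>2)"

lemma local_critical_radius:
  "0 \<le> local_critical_radius M u v" "local_critical_radius M u v \<le> pi / 2"
  "(cos (local_critical_radius M u v))\<^sup>2 = cos2_radius M u v"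
proof -
  define \<theta> where "\<theta> = local_critical_radius M u v"
  have *: "0 \<le> \<theta> \<and> \<theta> \<le> pi / 2 \<and> (if max_cot M u v \<le> 0 then \<theta> = pi / 2 else cot \<theta> = max_cot M u v)"
    unfolding \<theta>_def local_critical_radius_def by (rule theI'[OF local_critical_radius_ex1])
  then show "0 \<le> local_critical_radius M u v" "local_critical_radius M u v \<le> pi / 2"
    by (auto simp: \<theta>_def)
  show "(cos (local_critical_radius M u v))\<^sup>2 = cos2_radius M u v"
  proof (cases "max_cot M u v \<le> 0")
    case True
    then have "\<theta> = pi / 2" using * by argo
    then have "cos \<theta> = 0" by (simp only: cos_pi_half)
    then show ?thesis using True by (simp add: cos2_radius_def flip: \<theta>_def)
  next
    case False
    define m where "m = max_cot M u v"
    have m: "m > 0" "cot \<theta> = m" using False * by (auto simp: m_def)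
    then have "cos \<theta> = m * sin \<theta>"
      by (auto simp: cot_def field_simps)
    then have "(cos \<theta>)\<^sup>2 = m\<^sup>2 * (1 - (cos \<theta>)\<^sup>2)"
      by (metis power_mult_distrib sin_squared_eq)
    then have "(cos \<theta>)\<^sup>2 * (1 + m\<^sup>2) = m\<^sup>2"
      by (simp add: algebra_simps)
    moreover have "1 + m\<^sup>2 > 0"
      by (simp add: add_pos_nonneg)
    ultimately have "(cos \<theta>)\<^sup>2 = m\<^sup>2 / (1 + m\<^sup>2)"
      by (simp add: field_simps)
    then show ?thesis using False by (simp add: cos2_radius_def m_def max_def flip: \<theta>_def)
  qed
qed

lemma square_div_le_iff:
  fixes m x :: real
  assumes "x < 1"
  shows "m\<^sup>2 / (1 + m\<^sup>2) \<le> x \<longleftrightarrow> m\<^sup>2 \<le> x / (1 - x)"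
proof -
  have "1 + m\<^sup>2 > 0" by (simp add: add_pos_nonneg)
  then show ?thesis using assms by (simp add: pos_divide_le_eq pos_le_divide_eq algebra_simps)
qed

lemma cos2_radius_bounds: "0 \<le> cos2_radius M u v" "cos2_radius M u v < 1"
  by (auto simp: cos2_radius_def add_pos_nonneg pos_divide_less_eq)

text \<open>The map \<open>x\<^sup>2 / (1 + x\<^sup>2)\<close> is injective on nonnegative
  \<open>x\<close>.\<close>

lemma cos2_radius_eq_D:
  assumes "cos2_radius M u v = cos2_radius M u' v'"
  shows "max 0 (max_cot M u v) = max 0 (max_cot M u' v')"
proof -
  define x where "x = max 0 (max_cot M u v)"
  define y where "y = max 0 (max_cot M u' v')"
  have "1 + x\<^sup>2 > 0" "1 + y\<^sup>2 > 0" by (auto simp: add_pos_nonneg)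
  moreover have "x\<^sup>2 / (1 + x\<^sup>2) = y\<^sup>2 / (1 + y\<^sup>2)"
    using assms by (simp add: cos2_radius_def x_def y_def)
  ultimately have "x\<^sup>2 * (1 + y\<^sup>2) = y\<^sup>2 * (1 + x\<^sup>2)"
    by (simp add: frac_eq_eq)
  then have "x\<^sup>2 = y\<^sup>2" by (simp add: algebra_simps)
  moreover have "x \<ge> 0" "y \<ge> 0" by (auto simp: x_def y_def)
  ultimately show ?thesis by (simp add: power2_eq_iff_nonneg flip: x_def y_def)
qed

lemma cos2_radius_eq_0_D: "cos2_radius M u v = 0 \<Longrightarrow> max_cot M u v \<le> 0"
proof -
  assume *: "cos2_radius M u v = 0"
  have "1 + (max 0 (max_cot M u v))\<^sup>2 > 0" by (simp add: add_pos_nonneg)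
  then have "max 0 (max_cot M u v) = 0"
    using * by (simp add: cos2_radius_def)
  then show ?thesis by (simp add: max_def split: if_splits)
qed

text \<open>In the plane, the point at angle \<open>x\<close> from \<open>u\<close> contributes this
  quotient to \<open>max_cot\<close> along the tangent at \<open>u\<close>. It is the cotangent of
  \<open>x / 2\<close>, which decreases in \<open>x\<close>.\<close>

lemma sincos_half_ratio:
  fixes x :: real
  assumes "0 < x" "x < 2 * pi"
  shows "sin x / (1 - cos x) = cos (x / 2) / sin (x / 2)" "sin (x / 2) > 0" "cos x < 1"
proof -
  show s: "sin (x / 2) > 0" using assms by (intro sin_gt_zero) auto
  have c: "cos x = 1 - 2 * (sin (x / 2))\<^sup>2" "sin x = 2 * sin (x / 2) * cos (x / 2)"
    using cos_double_sin[of "x / 2"] sin_double[of "x / 2"] by simp_all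
  show "cos x < 1" using c s by simp
  show "sin x / (1 - cos x) = cos (x / 2) / sin (x / 2)"
    using s by (simp add: c power2_eq_square)
qed

section \<open>Local critical radii as a test for the maximizing point\<close>

locale unit_vectors =
  fixes M :: "(real^'n) set"
  assumes M: "finite M" "card M \<ge> 2" "M \<subseteq> sphere 0 1"
begin

lemma norm_M: "u \<in> M \<Longrightarrow> norm u = 1"
  using M by auto

lemma others: "finite (M - {u})" "M - {u} \<noteq> {}"
proof -
  show "finite (M - {u})" using M by simp
  have "M \<noteq> {}" "M \<noteq> {u}" using M(2) by auto
  then show "M - {u} \<noteq> {}" by auto
qed

lemma continuous_on_max_cot: "continuous_on UNIV (max_cot M u)"
proof -
  have "continuous_on UNIV (\<lambda>v. MAX w\<in>M - {u}. (w \<bullet> v) / (1 - u \<bullet> w))"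
    using others unfolding divide_inverse
    by (intro continuous_on_Max_image continuous_on_mult_right continuous_intros)
  then show ?thesis by (simp add: max_cot_def[abs_def])
qed

lemma continuous_on_cos2_radius: "continuous_on UNIV (cos2_radius M u)"
proof -
  have "1 + (max 0 (max_cot M u v))\<^sup>2 \<noteq> 0" for v
    using add_pos_nonneg[of 1 "(max 0 (max_cot M u v))\<^sup>2"] by simp
  then show ?thesis
    unfolding cos2_radius_def by (intro continuous_intros continuous_on_max_cot) auto
qed

lemma max_cot_le_iff:
  assumes "u \<in> M"
  shows "max_cot M u v \<le> a \<longleftrightarrow> (\<forall>w\<in>M - {u}. w \<bullet> v \<le> a * (1 - u \<bullet> w))"
proof -
  have "u \<bullet> w < 1" if "w \<in> M - {u}" for w
    using that assms norm_M by (intro inner_less_1_if_unit) auto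
  then show ?thesis
    using others by (simp add: max_cot_def pos_divide_le_eq)
qed

lemma max_cot_attained:
  assumes "u \<in> M"
  obtains w where "w \<in> M - {u}" "w \<bullet> v = max_cot M u v * (1 - u \<bullet> w)"
proof -
  have "max_cot M u v \<in> (\<lambda>w. (w \<bullet> v) / (1 - u \<bullet> w)) ` (M - {u})"
    unfolding max_cot_def using others by (intro Max_in) auto
  then obtain w where w: "w \<in> M - {u}" "max_cot M u v = (w \<bullet> v) / (1 - u \<bullet> w)"
    by blast
  moreover have "u \<bullet> w < 1"
    using w assms norm_M by (intro inner_less_1_if_unit) auto
  ultimately show ?thesis by (intro that[of w]) auto
qed

text \<open>
  With \<open>z = t u + s v\<close>, \<open>v = normal_dir u z\<close>, a point \<open>w\<close> satisfies \<open>w \<bullet> z \<le> u \<bullet> z\<close> iff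
  \<open>(w \<bullet> v) / (1 - u \<bullet> w) \<le> t / s\<close>.
\<close>
lemma maximizer_iff:
  assumes u: "u \<in> M" and z: "norm z = 1" "u \<bullet> z > 0" "(u \<bullet> z)\<^sup>2 \<noteq> 1"
  shows "(\<forall>w\<in>M. w \<bullet> z \<le> u \<bullet> z) \<longleftrightarrow> cos2_radius M u (normal_dir u z) \<le> (u \<bullet> z)\<^sup>2"
proof -
  define t where "t = u \<bullet> z"
  define s where "s = sqrt (1 - t\<^sup>2)"
  define v where "v = normal_dir u z"
  have "\<bar>t\<bar> \<le> 1"
    using Cauchy_Schwarz_ineq2[of u z] norm_M[OF u] z by (simp add: t_def)
  then have "t\<^sup>2 \<le> 1" by (simp add: abs_square_le_1)
  then have t: "t > 0" "t\<^sup>2 < 1" using z by (auto simp: t_def)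
  then have s: "s > 0" "s\<^sup>2 = 1 - t\<^sup>2" by (auto simp: s_def)
  have decomp: "z = t *\<^sub>R u + s *\<^sub>R v"
    using normal_dir_decomposition[OF norm_M[OF u] z(1)] by (simp add: t_def s_def v_def)
  have "(\<forall>w\<in>M. w \<bullet> z \<le> u \<bullet> z) \<longleftrightarrow> (\<forall>w\<in>M - {u}. w \<bullet> z \<le> t)"
    by (auto simp: t_def)
  also have "\<dots> \<longleftrightarrow> (\<forall>w\<in>M - {u}. w \<bullet> v \<le> t / s * (1 - u \<bullet> w))"
  proof (intro ball_cong refl)
    fix w
    have "w \<bullet> z = t * (u \<bullet> w) + s * (w \<bullet> v)"
      unfolding decomp by (simp add: inner_add_right inner_commute)
    then show "(w \<bullet> z \<le> t) = (w \<bullet> v \<le> t / s * (1 - u \<bullet> w))"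
      using s by (simp add: pos_le_divide_eq algebra_simps)
  qed
  also have "\<dots> \<longleftrightarrow> max_cot M u v \<le> t / s"
    by (rule max_cot_le_iff[OF u, symmetric])
  \<comment> \<open>As \<open>t / s\<close> is positive, cutting off at 0 changes nothing, and
    nonnegative numbers can be compared through their squares.\<close>
  also have "\<dots> \<longleftrightarrow> max 0 (max_cot M u v) \<le> t / s"
    using divide_pos_pos[OF t(1) s(1)] by simp
  also have "\<dots> \<longleftrightarrow> (max 0 (max_cot M u v))\<^sup>2 \<le> (t / s)\<^sup>2"
    using s t by (intro power_mono_iff[symmetric]) auto
  also have "(t / s)\<^sup>2 = t\<^sup>2 / (1 - t\<^sup>2)"
    by (simp add: power_divide s)
  also have "(max 0 (max_cot M u v))\<^sup>2 \<le> t\<^sup>2 / (1 - t\<^sup>2) \<longleftrightarrow> cos2_radius M u v \<le> t\<^sup>2"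
    unfolding cos2_radius_def using square_div_le_iff[OF t(2)] by blast
  finally show ?thesis by (simp add: t_def v_def)
qed

section \<open>Configurations with constant local critical radius\<close>

text \<open>If some other point \<open>w\<close> were not parallel to \<open>u\<close>, its
  normalised orthogonal part would be a unit normal \<open>v\<close> with
  \<open>w \<bullet> v > 0\<close>. Hence every other point is \<open>- u\<close>.\<close>

lemma antipodal_if_max_cot_nonpos:
  assumes "\<And>u v. u \<in> M \<Longrightarrow> v \<in> unit_normals u \<Longrightarrow> max_cot M u v \<le> 0"
  shows "antipodal_pair M"
proof -
  obtain u where u: "u \<in> M" using others(2) by blast
  have "w = - u" if w: "w \<in> M - {u}" for w
  proof -
    define p where "p = w - (u \<bullet> w) *\<^sub>R u"
    have uu: "u \<bullet> u = 1" using norm_M[OF u] by (simp add: norm_eq_1)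
    have pu: "p \<bullet> u = 0" by (simp add: p_def inner_diff_left uu) (simp add: inner_commute)
    have "p = 0"
    proof (rule ccontr)
      assume p: "p \<noteq> 0"
      define v where "v = inverse (norm p) *\<^sub>R p"
      have "v \<in> unit_normals u" using p pu by (simp add: unit_normals_def v_def)
      then have "w \<bullet> v \<le> 0"
        using assms[OF u] max_cot_le_iff[OF u, of v 0] w by simp
      moreover have "w \<bullet> p = p \<bullet> p"
        using pu by (simp add: p_def inner_diff_left inner_diff_right inner_commute uu)
      ultimately have "inverse (norm p) * (p \<bullet> p) \<le> 0" by (simp add: v_def)
      moreover have "inverse (norm p) * (p \<bullet> p) > 0" using p by simp
      ultimately show False by linarith
    qed
    then have w_eq: "w = (u \<bullet> w) *\<^sub>R u" by (simp add: p_def)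
    then have "norm w = \<bar>u \<bullet> w\<bar> * norm u" by (metis norm_scaleR)
    then have "\<bar>u \<bullet> w\<bar> = 1" using norm_M[OF u] norm_M[of w] w by (metis DiffD1 mult.right_neutral)
    then have "u \<bullet> w = 1 \<or> u \<bullet> w = - 1" by linarith
    moreover have "w = r *\<^sub>R u" if "u \<bullet> w = r" for r
      using w_eq unfolding that .
    ultimately have "w = 1 *\<^sub>R u \<or> w = (- 1) *\<^sub>R u" by blast
    then show "w = - u" using w by simp
  qed
  then have "M - {u} \<subseteq> {- u}" by (intro subsetI) simp
  then have "M - {u} = {- u}" using others(2)[of u] by (meson subset_singletonD)
  then have "M = {u, - u}" using u by (metis insert_Diff)
  then show ?thesis by (auto simp: antipodal_pair_def)
qed

text \<open>Maximality forces every unit normal to be one of the finitely many vectors \<open>a w / c\<close>.\<close>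
lemma finite_unit_normals_if_max_cot_const:
  assumes u: "u \<in> M" and c: "c > 0" "\<And>v. v \<in> unit_normals u \<Longrightarrow> max_cot M u v = c"
  shows "finite (unit_normals u)"
proof -
  \<comment> \<open>For \<open>v\<close> orthogonal to \<open>u\<close>, the quotient in
    \<open>max_cot\<close> is the inner product of \<open>v\<close> with \<open>a w\<close>. Taking
    \<open>v\<close> parallel to \<open>a w\<close> will bound the norm of \<open>a w\<close> by
    \<open>c\<close>.\<close>
  define a where "a w = (1 / (1 - u \<bullet> w)) *\<^sub>R (w - (u \<bullet> w) *\<^sub>R u)" for w
  have uu: "u \<bullet> u = 1" using norm_M[OF u] by (simp add: norm_eq_1)
  have au: "a w \<bullet> u = 0" for w
    by (simp add: a_def inner_diff_left uu) (simp add: inner_commute)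
  have av: "a w \<bullet> v = (w \<bullet> v) / (1 - u \<bullet> w)" if "v \<bullet> u = 0" for v w
    using that inner_commute[of u v] by (simp add: a_def inner_diff_left)
  have less: "u \<bullet> w < 1" if "w \<in> M - {u}" for w
    using that u norm_M by (intro inner_less_1_if_unit) auto
  have norm_a: "norm (a w) \<le> c" if w: "w \<in> M - {u}" for w
  proof (cases "a w = 0")
    case False
    define v where "v = inverse (norm (a w)) *\<^sub>R a w"
    have v: "v \<in> unit_normals u" using False au by (simp add: unit_normals_def v_def)
    then have "w \<bullet> v \<le> c * (1 - u \<bullet> w)"
      using c(2)[OF v] max_cot_le_iff[OF u, of v c] w by simp
    then have "a w \<bullet> v \<le> c"
      using v less[OF w] by (subst av) (auto simp: unit_normals_def pos_divide_le_eq)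
    moreover have "a w \<bullet> v = norm (a w)"
      using False by (simp add: v_def power2_norm_eq_inner[symmetric] power2_eq_square)
    ultimately show ?thesis by simp
  qed (use c in simp)
  have "unit_normals u \<subseteq> (\<lambda>w. (1 / c) *\<^sub>R a w) ` M"
  proof
    fix v assume v: "v \<in> unit_normals u"
    then have v': "v \<bullet> u = 0" "v \<bullet> v = 1" by (auto simp: unit_normals_def norm_eq_1)
    obtain w where w: "w \<in> M - {u}" "w \<bullet> v = c * (1 - u \<bullet> w)"
      using max_cot_attained[OF u, of v] c(2)[OF v] by metis
    have "a w \<bullet> v = c" using w less[OF w(1)] av[OF v'(1), of w] by simp
    \<comment> \<open>Equality case of Cauchy-Schwarz: \<open>a w\<close> has norm at most
      \<open>c\<close> and inner product \<open>c\<close> with the unit vector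
      \<open>v\<close>.\<close>
    then have "(norm (a w - c *\<^sub>R v))\<^sup>2 = (norm (a w))\<^sup>2 - c\<^sup>2"
      unfolding power2_norm_eq_inner
      by (simp add: inner_diff_left inner_diff_right inner_commute v' power2_eq_square)
    also have "\<dots> \<le> 0" using norm_a[OF w(1)] c by (simp add: power_mono)
    finally have "a w = c *\<^sub>R v" by simp
    then show "v \<in> (\<lambda>w. (1 / c) *\<^sub>R a w) ` M" using w c by (auto intro!: image_eqI[of _ _ w])
  qed
  then show ?thesis using M(1) finite_surj by blast
qed

end

text \<open>In dimension at least three, two orthonormal vectors orthogonal to \<open>u\<close> span
  an arc of unit normals.\<close>

lemma infinite_unit_normals:
  fixes u :: "real^'n"
  assumes "CARD('n) \<ge> 3"
  shows "infinite (unit_normals u)"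
proof -
  obtain x where x: "x \<noteq> 0" "u \<bullet> x = 0"
    using orthogonal_to_vector_exists[of u] assms by (auto simp: orthogonal_def)
  have "dim {u, x} < DIM(real^'n)"
    using dim_le_card'[of "{u, x}"] card_insert_le_m1[of 2 "{x}" u] assms by simp
  then obtain y where y: "y \<noteq> 0" "\<And>z. z \<in> span {u, x} \<Longrightarrow> orthogonal y z"
    using orthogonal_to_subspace_exists by blast
  then have y': "y \<bullet> u = 0" "y \<bullet> x = 0"
    using span_base[of u "{u, x}"] span_base[of x "{u, x}"] by (auto simp: orthogonal_def)
  define e where "e = inverse (norm x) *\<^sub>R x"
  define f where "f = inverse (norm y) *\<^sub>R y"
  have ef: "norm e = 1" "norm f = 1" "e \<bullet> u = 0" "f \<bullet> u = 0" "e \<bullet> f = 0"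
    using x y(1) y' by (simp_all add: e_def f_def inner_commute)
  define v where "v s = s *\<^sub>R e + sqrt (1 - s\<^sup>2) *\<^sub>R f" for s :: real
  have "v s \<in> unit_normals u" if "s \<in> {0..1}" for s
  proof -
    have "s\<^sup>2 \<le> 1" using that by (simp add: power_le_one)
    then have "v s \<bullet> v s = 1"
      using ef by (simp add: v_def inner_add_left inner_add_right inner_commute norm_eq_1)
        (simp add: power2_eq_square)
    then show ?thesis using ef by (simp add: unit_normals_def norm_eq_1 v_def inner_add_left)
  qed
  moreover have "inj_on v {0..1}"
  proof (rule inj_onI)
    fix s t assume "v s = v t"
    moreover have "v r \<bullet> e = r" for r
      using ef by (simp add: v_def inner_add_left norm_eq_1) (simp add: inner_commute)
    ultimately show "s = t" by metis
  qed
  moreover have "infinite {0..1::real}" by simp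
  ultimately show ?thesis
    by (meson finite_imageD finite_subset image_subsetI)
qed

lemma plane_polar:
  fixes a b y :: "real^'n"
  assumes "CARD('n) = 2" "norm a = 1" "norm b = 1" "a \<bullet> b = 0" "norm y = 1"
  obtains t where "0 \<le> t" "t < 2 * pi" "y = cos t *\<^sub>R a + sin t *\<^sub>R b"
proof -
  have ab: "a \<bullet> a = 1" "b \<bullet> b = 1" "b \<bullet> a = 0"
    using assms by (auto simp: norm_eq_1 inner_commute)
  then have "a \<noteq> b" "a \<noteq> 0" "b \<noteq> 0" using assms by auto
  have "independent {a, b}"
    using assms \<open>a \<noteq> 0\<close> \<open>b \<noteq> 0\<close>
    by (intro pairwise_orthogonal_independent) (auto simp: pairwise_def orthogonal_def inner_commute)
  then have "dim {a, b} = DIM(real^'n)"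
    using \<open>a \<noteq> b\<close> assms(1) by (simp add: dim_eq_card_independent)
  then have "y \<in> span {a, b}" using dim_eq_full by blast
  then obtain r s where y: "y = r *\<^sub>R a + s *\<^sub>R b"
    by (auto simp: span_breakdown_eq) (metis add.commute diff_add_cancel diff_eq_eq)
  have "y \<bullet> y = 1" using assms by (simp add: norm_eq_1)
  then have "r\<^sup>2 + s\<^sup>2 = 1"
    using assms(4) ab by (simp add: y inner_add_left inner_add_right power2_eq_square)
  then obtain t where "0 \<le> t" "t < 2 * pi" "r = cos t" "s = sin t"
    using sincos_total_2pi by metis
  then show ?thesis using that y by blast
qed

text \<open>Measure angles from a point of \<open>M\<close> in the direction of the tangent
  \<open>\<tau> t\<close>. Another point at angle \<open>x\<close> contributes the cotangent of
  \<open>x / 2\<close>, so the maximum comes from the next point. Its value \<open>c\<close> fixes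
  the gap, and equal gaps all the way round make \<open>M\<close> a regular polygon.\<close>

lemma (in unit_vectors) regular_polygon_if_max_cot_const:
  assumes n: "CARD('n) = 2" and c: "c > 0"
    and const: "\<And>u v. u \<in> M \<Longrightarrow> v \<in> unit_normals u \<Longrightarrow> max_cot M u v = c"
  shows "regular_polygon M"
proof -
  obtain a where a: "a \<in> M" using others(2) by blast
  obtain b' where b': "b' \<noteq> 0" "a \<bullet> b' = 0"
    using orthogonal_to_vector_exists[of a] n by (auto simp: orthogonal_def)
  define b where "b = inverse (norm b') *\<^sub>R b'"
  have ab: "norm a = 1" "norm b = 1" "a \<bullet> b = 0" "b \<bullet> a = 0" "a \<bullet> a = 1" "b \<bullet> b = 1"
    using b' norm_M[OF a] by (auto simp: b_def inner_commute norm_eq_1 power2_norm_eq_inner[symmetric] power2_eq_square)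
  define p where "p t = cos t *\<^sub>R a + sin t *\<^sub>R b" for t
  define \<tau> where "\<tau> t = (- sin t) *\<^sub>R a + cos t *\<^sub>R b" for t
  have p_p: "p t \<bullet> p (t + x) = cos x" for t x
  proof -
    have "p t \<bullet> p (t + x) = cos t * cos (t + x) + sin t * sin (t + x)"
      by (simp add: p_def inner_add_left inner_add_right ab)
    also have "\<dots> = cos ((t + x) - t)" unfolding cos_diff by (simp add: mult.commute)
    finally show ?thesis by simp
  qed
  have p_\<tau>: "p (t + x) \<bullet> \<tau> t = sin x" for t x
  proof -
    have "p (t + x) \<bullet> \<tau> t = sin (t + x) * cos t - cos (t + x) * sin t"
      by (simp add: p_def \<tau>_def inner_add_left inner_add_right inner_diff_right ab)
    also have "\<dots> = sin ((t + x) - t)" unfolding sin_diff by simp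
    finally show ?thesis by simp
  qed
  have p_add: "p (t + x) = cos x *\<^sub>R p t + sin x *\<^sub>R \<tau> t" for t x
    by (simp add: p_def \<tau>_def cos_add sin_add algebra_simps)
  have norm_p: "norm (p t) = 1" for t
    using p_p[of t 0] by (simp add: norm_eq_1)
  have norm_\<tau>: "norm (\<tau> t) = 1" for t
    by (simp add: norm_eq_1 \<tau>_def inner_add_left inner_add_right inner_diff_left inner_diff_right ab flip: power2_eq_square)
  have \<tau>: "\<tau> t \<in> unit_normals (p t)" for t
    using p_\<tau>[of t 0] norm_\<tau> by (simp add: unit_normals_def inner_commute)
  \<comment> \<open>The cotangent of \<open>d\<close> is \<open>c\<close>, so \<delta>, twice
    \<open>d\<close>, is the gap predicted by the half-angle formula.\<close>
  define d where "d = arctan (1 / c)"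
  define \<delta> where "\<delta> = 2 * d"
  have d: "0 < d" "d < pi / 2" using c arctan_ubound by (auto simp: d_def)
  then have sin_d: "sin d > 0" "cos d > 0" by (auto intro: sin_gt_zero cos_gt_zero)
  have "tan d = 1 / c" by (simp add: d_def tan_arctan)
  then have c_d: "c = cos d / sin d" using c sin_d by (simp add: tan_def field_simps)
  \<comment> \<open>The denominator on the right is positive, so the sign of
    \<open>sin (d - x / 2)\<close> decides whether the quotient exceeds \<open>c\<close>.\<close>
  have cmp: "sin x / (1 - cos x) - c = sin (d - x / 2) / (sin (x / 2) * sin d)" if "0 < x" "x < 2 * pi" for x
    unfolding sincos_half_ratio(1)[OF that] c_d sin_diff
    using sincos_half_ratio(2)[OF that] sin_d by (simp add: diff_frac_eq mult_ac)
  \<comment> \<open>A point less than \<delta> ahead would contribute more than the maximum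
    \<open>c\<close>.\<close>
  have gap: "\<delta> \<le> x" if t: "p t \<in> M" and x: "p (t + x) \<in> M" "0 < x" "x < 2 * pi" for t x
  proof (rule ccontr)
    assume "\<not> \<delta> \<le> x"
    then have "sin (d - x / 2) > 0" using x d by (intro sin_gt_zero) (auto simp: \<delta>_def)
    then have "sin x / (1 - cos x) > c"
      using cmp[OF x(2,3)] sin_d sincos_half_ratio[OF x(2,3)] by (simp add: zero_less_divide_iff) (smt (verit) divide_pos_pos mult_pos_pos)
    then have "sin x > c * (1 - cos x)"
      using sincos_half_ratio(3)[OF x(2,3)] by (simp add: pos_less_divide_eq)
    moreover have "p (t + x) \<noteq> p t"
      using p_p[of t x] sincos_half_ratio(3)[OF x(2,3)] norm_p[of t] by (auto simp: norm_eq_1)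
    ultimately show False
      using const[OF t \<tau>] max_cot_le_iff[OF t, of "\<tau> t" c] x(1) p_p[of t x] p_\<tau>[of t x] by force
  qed
  \<comment> \<open>A point attaining the maximum makes \<open>sin (d - x / 2)\<close> vanish; the
    range of \<open>x\<close> then leaves only the angle \<delta>.\<close>
  have step: "p (t + \<delta>) \<in> M" if t: "p t \<in> M" for t
  proof -
    obtain w where w: "w \<in> M - {p t}" "w \<bullet> \<tau> t = c * (1 - p t \<bullet> w)"
      using max_cot_attained[OF t, of "\<tau> t"] const[OF t \<tau>] by metis
    have "p t \<bullet> \<tau> t = 0" using p_\<tau>[of t 0] by simp
    then obtain x where x: "0 \<le> x" "x < 2 * pi" "w = p (t + x)"
      using plane_polar[OF n norm_p norm_\<tau>, of t t w] norm_M w(1) p_add by auto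
    then have x0: "0 < x" using w(1) by (cases "x = 0") auto
    have "sin x / (1 - cos x) = c"
      using w(2) p_p[of t x] p_\<tau>[of t x] x(3) sincos_half_ratio(3)[OF x0 x(2)] by (simp add: divide_eq_eq)
    then have "sin (d - x / 2) = 0"
      using cmp[OF x0 x(2)] sin_d sincos_half_ratio(2)[OF x0 x(2)] by simp
    moreover have "\<bar>d - x / 2\<bar> < pi" using d x0 x(2) by auto
    ultimately have "x = \<delta>"
      using sin_eq_0_pi[of "d - x / 2"] by (auto simp: \<delta>_def abs_less_iff)
    then show ?thesis using x w by auto
  qed
  have \<delta>: "0 < \<delta>" "\<delta> < pi" using d by (auto simp: \<delta>_def)
  have p0: "p 0 = a" by (simp add: p_def)
  have multiples: "p (real k * \<delta>) \<in> M" for k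
  proof (induction k)
    case (Suc k)
    then show ?case using step[OF Suc] by (simp add: algebra_simps)
  qed (simp add: p0 a)
  \<comment> \<open>The excess of \<open>s\<close> over the largest multiple of \<delta> below it is
    less than \<delta>, so \<open>gap\<close> forces it to be 0.\<close>
  have on_grid: "\<exists>k::nat. s = real k * \<delta>" if s: "s \<ge> 0" "p s \<in> M" for s
  proof -
    define k where "k = nat \<lfloor>s / \<delta>\<rfloor>"
    have "s / \<delta> \<ge> 0" using s \<delta> by simp
    then have "real k \<le> s / \<delta>" "s / \<delta> < real k + 1"
      by (auto simp: k_def)
    then have x: "real k * \<delta> \<le> s" "s < real k * \<delta> + \<delta>"
      using \<delta> by (auto simp: field_simps)
    have "s = real k * \<delta>"
      using gap[OF multiples[of k], of "s - real k * \<delta>"] s x \<delta> by force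
    then show ?thesis by blast
  qed
  \<comment> \<open>A full turn ends at \<open>a\<close> again, so it consists of a whole number of
    gaps.\<close>
  have "p (2 * pi) \<in> M" by (simp add: p_def a)
  then obtain K :: nat where K: "2 * pi = real K * \<delta>" using on_grid[of "2 * pi"] by auto
  have M_eq: "M = (\<lambda>k. p (real k * \<delta>)) ` {..<K}"
  proof (intro equalityI subsetI)
    fix w assume w: "w \<in> M"
    obtain s where s: "0 \<le> s" "s < 2 * pi" "w = p s"
      using plane_polar[OF n ab(1-3) norm_M[OF w]] by (auto simp: p_def)
    then obtain k :: nat where k: "s = real k * \<delta>" using on_grid w by blast
    then have "k < K" using s K \<delta> by simp
    then show "w \<in> (\<lambda>k. p (real k * \<delta>)) ` {..<K}" using s k by auto
  qed (use multiples in auto)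
  \<comment> \<open>Two different grid indices below \<open>K\<close> differ by an angle strictly
    between 0 and \<open>2 * pi\<close>; this identifies \<open>K\<close> as the number of
    points.\<close>
  have "inj_on (\<lambda>k. p (real k * \<delta>)) {..<K}"
  proof (rule linorder_inj_onI')
    fix i j assume ij: "i \<in> {..<K}" "j \<in> {..<K}" "i < j"
    define x where "x = real (j - i) * \<delta>"
    have "real (j - i) < real K" using ij by simp
    then have "x < 2 * pi" unfolding x_def K using \<delta> by (intro mult_strict_right_mono)
    moreover have "x > 0" using ij \<delta> by (simp add: x_def)
    moreover have "real j * \<delta> = real i * \<delta> + x" using ij by (simp add: x_def of_nat_diff algebra_simps)
    ultimately show "p (real i * \<delta>) \<noteq> p (real j * \<delta>)"
      using p_p[of "real i * \<delta>" x] sincos_half_ratio(3)[of x] norm_p[of "real i * \<delta>"]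
      by (auto simp: norm_eq_1)
  qed
  then have card: "card M = K" by (simp add: M_eq card_image)
  then have "K > 0" using M(2) by simp
  then have "\<delta> = 2 * pi / real (card M)" using K card by (simp add: field_simps)
  then have "M = (\<lambda>k. cos (2 * pi * real k / real (card M)) *\<^sub>R a
      + sin (2 * pi * real k / real (card M)) *\<^sub>R b) ` {..<card M}"
    using M_eq card by (simp add: p_def mult.commute)
  then show ?thesis
    unfolding regular_polygon_def using ab by blast
qed

text \<open>For positive \<open>c\<close> the unit normals form a finite set, which rules out
  dimensions above two; otherwise every \<open>max_cot\<close> value is nonpositive.\<close>

lemma (in unit_vectors) degenerate_if_max_cot_const:
  assumes n: "CARD('n) \<ge> 2"
    and const: "\<And>u v. u \<in> M \<Longrightarrow> v \<in> unit_normals u \<Longrightarrow> max 0 (max_cot M u v) = c"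
  shows "antipodal_pair M \<or> CARD('n) = 2 \<and> regular_polygon M"
proof (cases "c > 0")
  case False
  have "max_cot M u v \<le> 0" if "u \<in> M" "v \<in> unit_normals u" for u v
    using const[OF that] False by (simp add: max_def split: if_splits)
  then show ?thesis using antipodal_if_max_cot_nonpos by blast
next
  case True
  have *: "max_cot M u v = c" if "u \<in> M" "v \<in> unit_normals u" for u v
    using const[OF that] True by (simp add: max_def split: if_splits)
  obtain u where "u \<in> M" using others(2) by blast
  then have "finite (unit_normals u)"
    using finite_unit_normals_if_max_cot_const True * by blast
  then have "CARD('n) = 2" using infinite_unit_normals[of u] n by force
  then show ?thesis using regular_polygon_if_max_cot_const True * by blast
qed

section \<open>Regularly varying tails\<close>

text \<open>Variant of regular variation for a tail function that may differ from \<open>G\<close> by atoms.\<close>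
lemma regular_variation_sandwich:
  fixes G T :: "real \<Rightarrow> real"
  assumes G_pos: "\<And>x. x > 0 \<Longrightarrow> G x > 0"
    and T: "\<And>x. G x \<le> T x" "\<And>x y. x < y \<Longrightarrow> T y \<le> G x"
    and lim: "\<And>l. l > 0 \<Longrightarrow> ((\<lambda>x. G (l * x) / G x) \<longlongrightarrow> l powr \<alpha>) at_top"
    and l: "l > 0"
  shows "((\<lambda>x. T (l * x) / G x) \<longlongrightarrow> l powr \<alpha>) at_top"
proof (rule order_tendstoI)
  fix a assume "a < l powr \<alpha>"
  from order_tendstoD(1)[OF lim[OF l] this] eventually_gt_at_top[of 0]
  show "eventually (\<lambda>x. a < T (l * x) / G x) at_top"
  proof eventually_elim
    case (elim x)
    have "G (l * x) / G x \<le> T (l * x) / G x"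
      using G_pos[OF elim(2)] T(1) by (intro divide_right_mono) auto
    then show ?case using elim by linarith
  qed
next
  fix a assume a: "l powr \<alpha> < a"
  \<comment> \<open>Continuity provides \<open>k < l\<close> whose power is still below
    \<open>a\<close>; the strict inequality \<open>k * x < l * x\<close> then bounds
    \<open>T\<close> at \<open>l * x\<close> by \<open>G\<close> at \<open>k * x\<close>.\<close>
  have "((\<lambda>x. x powr \<alpha>) \<longlongrightarrow> l powr \<alpha>) (at_left l)"
    using l by (intro tendsto_intros) auto
  from order_tendstoD(2)[OF this a] have "eventually (\<lambda>x. x powr \<alpha> < a) (at_left l)" .
  moreover have "eventually (\<lambda>x. x \<in> {0<..<l}) (at_left l)"
    using l by (rule eventually_at_left_real)
  ultimately have "eventually (\<lambda>x. x powr \<alpha> < a \<and> x \<in> {0<..<l}) (at_left l)"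
    by (rule eventually_conj)
  then obtain k where k: "k powr \<alpha> < a" "0 < k" "k < l"
    using eventually_happens'[OF trivial_limit_at_left_real] by fastforce
  from order_tendstoD(2)[OF lim[OF k(2)] k(1)] eventually_gt_at_top[of 0]
  show "eventually (\<lambda>x. T (l * x) / G x < a) at_top"
  proof eventually_elim
    case (elim x)
    have "T (l * x) / G x \<le> G (k * x) / G x"
      using G_pos[OF elim(2)] k elim by (intro divide_right_mono T(2)) auto
    then show ?case using elim by linarith
  qed
qed

locale heavy_tailed_spherical = prob_space P for P :: "'a measure" +
  fixes r :: "'a \<Rightarrow> real" and \<eta> \<xi> :: "'a \<Rightarrow> real^'n" and \<gamma> :: real
  assumes ind: "indep_rvs P r \<eta>" and r_pos: "AE \<omega> in P. 0 < r \<omega>"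
    and \<eta>_norm: "AE \<omega> in P. norm (\<eta> \<omega>) = 1"
    and \<xi>: "\<And>\<omega>. \<omega> \<in> space P \<Longrightarrow> \<xi> \<omega> = r \<omega> *\<^sub>R \<eta> \<omega>"
    and \<gamma>: "0 < \<gamma>" and RV: "cdf (distr P borel (\<lambda>\<omega>. (norm (\<xi> \<omega>))\<^sup>2)) \<in> RV (- \<gamma>)"
begin

definition tail :: "real \<Rightarrow> real" where
  "tail x = 1 - cdf (distr P borel (\<lambda>\<omega>. (norm (\<xi> \<omega>))\<^sup>2)) x"

lemma measurable_r_\<eta> [measurable]: "r \<in> borel_measurable P" "\<eta> \<in> borel_measurable P"
  using ind by (auto simp: indep_rvs_def)

lemma measurable_\<xi> [measurable]: "\<xi> \<in> borel_measurable P"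
proof -
  have "(\<lambda>\<omega>. r \<omega> *\<^sub>R \<eta> \<omega>) \<in> borel_measurable P" by measurable
  then show ?thesis by (rule measurable_cong[THEN iffD1, rotated]) (simp add: \<xi>)
qed

lemma tail_pos: "x > 0 \<Longrightarrow> tail x > 0"
  using RV by (simp add: tail_def RV_def)

lemma tail_eq: "tail x = prob {\<omega>\<in>space P. x < (r \<omega>)\<^sup>2}"
proof -
  have "tail x = 1 - prob {\<omega>\<in>space P. (norm (\<xi> \<omega>))\<^sup>2 \<le> x}"
    unfolding tail_def cdf_def by (subst measure_distr) (auto intro!: arg_cong[where f = prob])
  also have "\<dots> = prob {\<omega>\<in>space P. \<not> (norm (\<xi> \<omega>))\<^sup>2 \<le> x}"
    by (subst prob_neg) auto
  also have "\<dots> = prob {\<omega>\<in>space P. x < (r \<omega>)\<^sup>2}"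
  proof (rule finite_measure_eq_AE)
    show "AE \<omega> in P. \<omega> \<in> {\<omega>\<in>space P. \<not> (norm (\<xi> \<omega>))\<^sup>2 \<le> x} \<longleftrightarrow> \<omega> \<in> {\<omega>\<in>space P. x < (r \<omega>)\<^sup>2}"
      using \<eta>_norm by eventually_elim (auto simp: \<xi>)
  qed auto
  finally show ?thesis .
qed

text \<open>The events to be estimated are closed conditions on the squared radius, whereas
  \<open>tail\<close> is strict, so atoms have to be absorbed.\<close>

lemma tail_ratio:
  assumes "l > 0"
  shows "((\<lambda>x. prob {\<omega>\<in>space P. l * x \<le> (r \<omega>)\<^sup>2} / tail x) \<longlongrightarrow> l powr (- \<gamma>)) at_top"
proof (rule regular_variation_sandwich[where T = "\<lambda>x. prob {\<omega>\<in>space P. x \<le> (r \<omega>)\<^sup>2}"])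
  show "tail x \<le> prob {\<omega>\<in>space P. x \<le> (r \<omega>)\<^sup>2}" for x
    unfolding tail_eq by (rule finite_measure_mono) auto
  show "prob {\<omega>\<in>space P. y \<le> (r \<omega>)\<^sup>2} \<le> tail x" if "x < y" for x y
    unfolding tail_eq using that by (intro finite_measure_mono) auto
  show "((\<lambda>x. tail (l * x) / tail x) \<longlongrightarrow> l powr - \<gamma>) at_top" if "l > 0" for l
    using RV that by (simp add: RV_def tail_def)
qed (use tail_pos assms in auto)

text \<open>Given direction \<open>y\<close> with \<open>f y > 0\<close>, the event says that the
  squared radius is at least \<open>c\<^sup>2 / (f y)\<^sup>2\<close>, and regular variation yields
  the weight \<open>f y powr (2 * \<gamma>)\<close>. Positive homogeneity is shared by a single
  inner product and by the maximum of several, so both are covered.\<close>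

lemma directional_tail:
  assumes f [measurable]: "f \<in> borel_measurable borel"
    and hom: "\<And>x y. x > 0 \<Longrightarrow> f (x *\<^sub>R y) = x * f y"
    and le: "\<And>y. norm y = 1 \<Longrightarrow> f y \<le> 1"
  shows "((\<lambda>c. prob {\<omega>\<in>space P. c \<le> f (\<xi> \<omega>)} / tail (c\<^sup>2)) \<longlongrightarrow>
    (\<integral>y. (max 0 (f y)) powr (2 * \<gamma>) \<partial>distr P borel \<eta>)) at_top"
proof -
  define \<mu> where "\<mu> = distr P borel \<eta>"
  define \<rho> where "\<rho> = distr P borel r"
  interpret \<mu>: prob_space \<mu> unfolding \<mu>_def by (rule prob_space_distr) measurable
  interpret \<rho>: prob_space \<rho> unfolding \<rho>_def by (rule prob_space_distr) measurable
  interpret pair_sigma_finite \<rho> \<mu> ..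
  have [measurable_cong, simp]: "sets \<mu> = sets borel" "sets \<rho> = sets borel"
    by (auto simp: \<mu>_def \<rho>_def)
  have [simp]: "space \<mu> = UNIV" "space \<rho> = UNIV" by (auto simp: \<mu>_def \<rho>_def)
  \<comment> \<open>The conditional probability of the event given that the direction is
    \<open>y\<close>.\<close>
  define h where "h c y = measure \<rho> {x. c \<le> x * f y}" for c y
  have [measurable]: "h c \<in> borel_measurable borel" for c
  proof -
    have "{z \<in> space (\<mu> \<Otimes>\<^sub>M \<rho>). c \<le> snd z * f (fst z)} \<in> sets (\<mu> \<Otimes>\<^sub>M \<rho>)"
      by measurable
    from \<rho>.measurable_emeasure_Pair[OF this]
    have "(\<lambda>y. emeasure \<rho> {x. c \<le> x * f y}) \<in> borel_measurable \<mu>"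
      by (simp add: space_pair_measure vimage_def)
    then have "(\<lambda>y. enn2real (emeasure \<rho> {x. c \<le> x * f y})) \<in> borel_measurable borel"
      by measurable
    then show ?thesis by (simp add: h_def[abs_def] measure_def)
  qed
  have prob_eq: "prob {\<omega>\<in>space P. c \<le> f (\<xi> \<omega>)} = (\<integral>y. h c y \<partial>\<mu>)" for c
  proof -
    have A: "{z \<in> space (\<rho> \<Otimes>\<^sub>M \<mu>). c \<le> fst z * f (snd z)} \<in> sets (\<rho> \<Otimes>\<^sub>M \<mu>)"
      by measurable
    then have A': "{(x, y). c \<le> x * f y} \<in> sets (\<rho> \<Otimes>\<^sub>M \<mu>)"
      by (simp add: space_pair_measure case_prod_beta')
    then have A'' [measurable]: "{(x, y). c \<le> x * f y} \<in> sets (borel \<Otimes>\<^sub>M borel)"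
      by (simp cong: sets_pair_measure_cong)
    have "prob {\<omega>\<in>space P. c \<le> f (\<xi> \<omega>)} = prob {\<omega>\<in>space P. c \<le> r \<omega> * f (\<eta> \<omega>)}"
    proof (rule finite_measure_eq_AE)
      show "AE \<omega> in P. \<omega> \<in> {\<omega>\<in>space P. c \<le> f (\<xi> \<omega>)} \<longleftrightarrow> \<omega> \<in> {\<omega>\<in>space P. c \<le> r \<omega> * f (\<eta> \<omega>)}"
        using r_pos by eventually_elim (auto simp: \<xi> hom)
    qed auto
    then have "ennreal (prob {\<omega>\<in>space P. c \<le> f (\<xi> \<omega>)}) = emeasure P {\<omega>\<in>space P. c \<le> r \<omega> * f (\<eta> \<omega>)}"
      by (simp add: emeasure_eq_measure)
    also have "\<dots> = emeasure (distr P (borel \<Otimes>\<^sub>M borel) (\<lambda>\<omega>. (r \<omega>, \<eta> \<omega>))) {(x, y). c \<le> x * f y}"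
      by (subst emeasure_distr) (auto intro!: arg_cong[where f = "emeasure P"])
    also have "\<dots> = emeasure (\<rho> \<Otimes>\<^sub>M \<mu>) {(x, y). c \<le> x * f y}"
      by (simp add: \<rho>_def \<mu>_def indep_rvs_distr_pair[OF prob_space_axioms ind])
    also have "\<dots> = (\<integral>\<^sup>+y. emeasure \<rho> {x. c \<le> x * f y} \<partial>\<mu>)"
      by (subst emeasure_pair_measure_alt2[OF A']) (simp add: vimage_def)
    also have "\<dots> = (\<integral>\<^sup>+y. ennreal (h c y) \<partial>\<mu>)"
      by (simp add: h_def \<rho>.emeasure_eq_measure)
    finally have *: "ennreal (prob {\<omega>\<in>space P. c \<le> f (\<xi> \<omega>)}) = (\<integral>\<^sup>+y. ennreal (h c y) \<partial>\<mu>)" .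
    have "(\<integral>y. h c y \<partial>\<mu>) = enn2real (\<integral>\<^sup>+y. ennreal (h c y) \<partial>\<mu>)"
      by (rule integral_eq_nn_integral) (auto simp: h_def)
    then show ?thesis by (simp flip: *)
  qed
  have \<rho>_pos: "AE x in \<rho>. x > 0"
    unfolding \<rho>_def using r_pos by (subst AE_distr_iff) auto
  have h_pos: "h c y = prob {\<omega>\<in>space P. (1 / (f y)\<^sup>2) * c\<^sup>2 \<le> (r \<omega>)\<^sup>2}" if "c > 0" "f y > 0" for c y
  proof -
    have "h c y = prob {\<omega>\<in>space P. c \<le> r \<omega> * f y}"
      unfolding h_def \<rho>_def by (subst measure_distr) (auto intro!: arg_cong[where f = prob])
    also have "\<dots> = prob {\<omega>\<in>space P. (1 / (f y)\<^sup>2) * c\<^sup>2 \<le> (r \<omega>)\<^sup>2}"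
    proof (rule finite_measure_eq_AE)
      show "AE \<omega> in P. \<omega> \<in> {\<omega>\<in>space P. c \<le> r \<omega> * f y} \<longleftrightarrow>
          \<omega> \<in> {\<omega>\<in>space P. (1 / (f y)\<^sup>2) * c\<^sup>2 \<le> (r \<omega>)\<^sup>2}"
        using r_pos
      proof eventually_elim
        case (elim \<omega>)
        have "c \<le> r \<omega> * f y \<longleftrightarrow> c\<^sup>2 \<le> (r \<omega> * f y)\<^sup>2"
          using that elim by (intro power_mono_iff[symmetric]) auto
        also have "\<dots> \<longleftrightarrow> (1 / (f y)\<^sup>2) * c\<^sup>2 \<le> (r \<omega>)\<^sup>2"
          using that by (simp add: power_mult_distrib pos_divide_le_eq)
        finally show ?case by simp
      qed
    qed auto
    finally show ?thesis .
  qed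
  have h_zero: "h c y = 0" if "c > 0" "f y \<le> 0" for c y
  proof -
    have "AE x in \<rho>. x \<notin> {x. c \<le> x * f y}"
      using \<rho>_pos
    proof eventually_elim
      case (elim x)
      then have "x * f y \<le> 0" using that by (simp add: mult_le_0_iff)
      then show ?case using that by simp
    qed
    then have "measure \<rho> {x. c \<le> x * f y} = measure \<rho> {}"
      by (intro \<rho>.finite_measure_eq_AE) auto
    then show ?thesis by (simp add: h_def)
  qed
  have sq: "filterlim (\<lambda>c::real. c\<^sup>2) at_top at_top"
    by (rule filterlim_pow_at_top) (auto simp: filterlim_ident)
  have "((\<lambda>c. \<integral>y. h c y / tail (c\<^sup>2) \<partial>\<mu>) \<longlongrightarrow> (\<integral>y. (max 0 (f y)) powr (2 * \<gamma>) \<partial>\<mu>)) at_top"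
  proof (rule integral_dominated_convergence_at_top[where w = "\<lambda>_. 2"])
    show "AE y in \<mu>. ((\<lambda>c. h c y / tail (c\<^sup>2)) \<longlongrightarrow> max 0 (f y) powr (2 * \<gamma>)) at_top"
    proof (rule AE_I2)
      fix y
      show "((\<lambda>c. h c y / tail (c\<^sup>2)) \<longlongrightarrow> max 0 (f y) powr (2 * \<gamma>)) at_top"
      proof (cases "f y > 0")
        case True
        then have "((\<lambda>c. prob {\<omega>\<in>space P. (1 / (f y)\<^sup>2) * c\<^sup>2 \<le> (r \<omega>)\<^sup>2} / tail (c\<^sup>2)) \<longlongrightarrow> (1 / (f y)\<^sup>2) powr (- \<gamma>)) at_top"
          by (intro filterlim_compose[OF tail_ratio sq]) simp
        also have "(1 / (f y)\<^sup>2) powr (- \<gamma>) = max 0 (f y) powr (2 * \<gamma>)"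
        proof -
          have "(1 / (f y)\<^sup>2) powr (- \<gamma>) = ((f y)\<^sup>2) powr \<gamma>"
            using True by (simp add: powr_divide powr_minus field_simps)
          also have "\<dots> = f y powr (2 * \<gamma>)"
            using True by (simp add: powr_powr flip: powr_numeral)
          finally show ?thesis using True by simp
        qed
        finally show ?thesis
          by (rule Lim_transform_eventually)
            (use eventually_gt_at_top[of 0] in eventually_elim, use True h_pos in simp)
      next
        case False
        have "eventually (\<lambda>c. h c y / tail (c\<^sup>2) = max 0 (f y) powr (2 * \<gamma>)) at_top"
          using eventually_gt_at_top[of "0 :: real"]
        proof eventually_elim
          case (elim c)
          then show ?case using h_zero[of c y] False by simp
        qed
        then show ?thesis by (rule tendsto_eventually)
      qed
    qed
    \<comment> \<open>At \<open>l = 1\<close> the ratio tends to 1, so it is eventually below the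
      dominating constant 2. As \<open>f y \<le> 1\<close> on the sphere, this case bounds all
      directions.\<close>
    have "((\<lambda>c. prob {\<omega>\<in>space P. 1 * c\<^sup>2 \<le> (r \<omega>)\<^sup>2} / tail (c\<^sup>2)) \<longlongrightarrow> 1 powr (- \<gamma>)) at_top"
      by (intro filterlim_compose[OF tail_ratio sq]) simp
    then have "eventually (\<lambda>c. prob {\<omega>\<in>space P. c\<^sup>2 \<le> (r \<omega>)\<^sup>2} / tail (c\<^sup>2) < 2) at_top"
      by (auto dest: order_tendstoD(2)[where a = 2])
    then show "eventually (\<lambda>c. AE y in \<mu>. norm (h c y / tail (c\<^sup>2)) \<le> 2) at_top"
      using eventually_gt_at_top[of 0]
    proof eventually_elim
      case (elim c)
      have "norm (h c y / tail (c\<^sup>2)) \<le> 2" if "norm y = 1" for y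
      proof (cases "f y > 0")
        case True
        have "1 \<le> 1 / (f y)\<^sup>2" using True le[OF that] by (simp add: power_le_one)
        then have *: "c\<^sup>2 \<le> (1 / (f y)\<^sup>2) * c\<^sup>2" using mult_right_mono[of 1 "1 / (f y)\<^sup>2" "c\<^sup>2"] by simp
        have "h c y \<le> prob {\<omega>\<in>space P. c\<^sup>2 \<le> (r \<omega>)\<^sup>2}"
          unfolding h_pos[OF elim(2) True] using * by (intro finite_measure_mono) auto
        then have "h c y / tail (c\<^sup>2) \<le> prob {\<omega>\<in>space P. c\<^sup>2 \<le> (r \<omega>)\<^sup>2} / tail (c\<^sup>2)"
          using tail_pos[of "c\<^sup>2"] elim by (intro divide_right_mono) auto
        then show ?thesis
          using elim tail_pos[of "c\<^sup>2"] by (simp add: h_def)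
      qed (use h_zero elim in simp)
      moreover have "AE y in \<mu>. norm y = 1"
        unfolding \<mu>_def using \<eta>_norm by (subst AE_distr_iff) auto
      ultimately show ?case by (auto elim: eventually_mono)
    qed
  qed auto
  then show ?thesis
    unfolding \<mu>_def[symmetric] prob_eq by simp
qed

end

section \<open>Full support\<close>

text \<open>Reflections carry balls of equal radius centred on the sphere of \<open>W\<close> to
  each other, so these have equal measure. By compactness finitely many of them cover the sphere,
  which has mass 1.\<close>

lemma refl_uniform_full_support:
  fixes \<sigma> :: "'a::euclidean_space measure"
  assumes \<sigma>: "refl_uniform W \<sigma>" and W: "subspace W" and x: "x \<in> W" "norm x = 1" and U: "open U" "x \<in> U"
  shows "measure \<sigma> U > 0"
proof -
  interpret prob_space \<sigma> by (rule refl_uniformD(1)[OF \<sigma>])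
  have [measurable_cong, simp]: "sets \<sigma> = sets borel" by (rule refl_uniformD(2)[OF \<sigma>])
  have [simp]: "space \<sigma> = UNIV" using sets_eq_imp_space_eq[OF refl_uniformD(2)[OF \<sigma>]] by simp
  obtain e where e: "e > 0" "ball x e \<subseteq> U" using U openE by blast
  define S where "S = W \<inter> sphere 0 1"
  have "compact S" unfolding S_def using closed_subspace[OF W] by (simp add: closed_Int_compact)
  have eq: "measure \<sigma> (ball y e) = measure \<sigma> (ball x e)" if y: "y \<in> S" for y
  proof -
    define f where "f = refl_along (x - y)"
    have fx: "f x = y" using x y by (simp add: f_def S_def refl_along_diff)
    have "f -` ball y e = ball x e"
    proof -
      have "dist y (f z) = dist x z" for z
        using norm_refl_along[of "x - y" "x - z"] fx
        by (simp add: dist_norm f_def linear_diff[OF linear_refl_along])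
      then show ?thesis by auto
    qed
    moreover have "measure \<sigma> (ball y e) = measure (distr \<sigma> borel f) (ball y e)"
      using refl_uniformD(4)[OF \<sigma>, of "x - y"] W x y by (simp add: f_def S_def subspace_diff)
    ultimately show ?thesis
      by (simp add: measure_distr f_def)
  qed
  have "measure \<sigma> (ball x e) > 0"
  proof (rule ccontr)
    assume "\<not> measure \<sigma> (ball x e) > 0"
    then have zero: "measure \<sigma> (ball y e) = 0" if "y \<in> S" for y
      using eq[OF that] by (simp add: order.antisym not_less)
    have "S \<subseteq> (\<Union>y\<in>S. ball y e)" using e by auto
    then obtain D where D: "D \<subseteq> S" "finite D" "S \<subseteq> (\<Union>y\<in>D. ball y e)"
      using compactE_image[OF \<open>compact S\<close>, of S "\<lambda>y. ball y e"] by auto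
    have "AE y in \<sigma>. y \<in> (\<Union>y\<in>D. ball y e)"
      using refl_uniformD(3)[OF \<sigma>] by eventually_elim (rule subsetD[OF D(3)], simp add: S_def)
    then have "measure \<sigma> (\<Union>y\<in>D. ball y e) = 1"
      using D(2) by (subst prob_eq_1) auto
    moreover have "measure \<sigma> (\<Union>y\<in>D. ball y e) \<le> (\<Sum>y\<in>D. measure \<sigma> (ball y e))"
      using D(2) by (intro finite_measure_subadditive_finite) auto
    moreover have "(\<Sum>y\<in>D. measure \<sigma> (ball y e)) = 0"
      using zero D(1) by (intro sum.neutral) auto
    ultimately show False by simp
  qed
  also have "\<dots> \<le> measure \<sigma> U"
    using e U by (intro finite_measure_mono) auto
  finally show ?thesis .
qed

lemma beta_distributed_interval_pos:
  assumes "prob_space Q" and B: "distributed Q lborel B (\<lambda>x. ennreal (beta_density p q x))"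
    and "p > 0" "q > 0" "0 \<le> a" "a < b" "b \<le> 1"
  shows "measure Q {\<omega>\<in>space Q. a < B \<omega> \<and> B \<omega> < b} > 0"
proof -
  interpret prob_space Q by fact
  have "emeasure Q {\<omega>\<in>space Q. a < B \<omega> \<and> B \<omega> < b} = emeasure Q (B -` {a<..<b} \<inter> space Q)"
    by (rule arg_cong[where f = "emeasure Q"]) auto
  also have "\<dots> = (\<integral>\<^sup>+x. ennreal (beta_density p q x) * indicator {a<..<b} x \<partial>lborel)"
    using B by (rule distributed_emeasure) auto
  also have "\<dots> \<noteq> 0"
  proof
    assume "(\<integral>\<^sup>+x. ennreal (beta_density p q x) * indicator {a<..<b} x \<partial>lborel) = 0"
    then have "AE x in lborel. ennreal (beta_density p q x) * indicator {a<..<b} x = 0"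
      by (subst (asm) nn_integral_0_iff_AE) auto
    then have "AE x in lborel. x \<notin> {a<..<b}"
    proof eventually_elim
      case (elim x)
      then show ?case
        using beta_density_pos[OF assms(3,4), of x] assms by (auto simp: indicator_def split: if_splits)
    qed
    then have "emeasure lborel {a<..<b} = 0"
      by (subst (asm) AE_iff_measurable[of "{a<..<b}"]) auto
    then show False using assms by simp
  qed
  finally show ?thesis
    by (simp add: emeasure_eq_measure zero_less_measure_iff)
qed

lemma indep_rvs_prob:
  assumes "prob_space Q" "indep_rvs Q X Y" "A \<in> sets borel" "C \<in> sets borel"
  shows "measure Q {\<omega>\<in>space Q. X \<omega> \<in> A \<and> Y \<omega> \<in> C} =
    measure Q {\<omega>\<in>space Q. X \<omega> \<in> A} * measure Q {\<omega>\<in>space Q. Y \<omega> \<in> C}"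
proof -
  interpret prob_space Q by fact
  have "prob ((X -` A \<inter> space Q) \<inter> (Y -` C \<inter> space Q)) = prob (X -` A \<inter> space Q) * prob (Y -` C \<inter> space Q)"
    using assms by (intro indep_setD) (auto simp: indep_rvs_def)
  then show ?thesis
    by (simp add: vimage_def Int_def conj_ac)
qed

section \<open>The limit of the Bonferroni error\<close>

locale bonferroni_setting =
  unit_vectors M + heavy_tailed_spherical P r \<eta> \<xi> \<gamma> + Q: prob_space Q
  for M :: "(real^'n) set" and P :: "'a measure" and r :: "'a \<Rightarrow> real"
    and \<eta> \<xi> :: "'a \<Rightarrow> real^'n" and \<gamma> :: real and Q :: "'b measure" +
  fixes B :: "'b \<Rightarrow> real" and V :: "real^'n \<Rightarrow> 'b \<Rightarrow> real^'n"
  assumes n: "CARD('n) \<ge> 2"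
    and \<eta>: "refl_uniform UNIV (distr P borel \<eta>)"
    and B: "distributed Q lborel B (\<lambda>x. ennreal (beta_density (\<gamma> + 1/2) ((real CARD('n) - 1) / 2) x))"
    and indep_B_V: "\<And>u. u \<in> M \<Longrightarrow> indep_rvs Q B (V u)"
    and V: "\<And>u. u \<in> M \<Longrightarrow> refl_uniform {v. v \<bullet> u = 0} (distr Q borel (V u))"
begin

section \<open>Notation, measurability and almost sure properties\<close>

abbreviation \<mu> :: "(real^'n) measure" where "\<mu> \<equiv> distr P borel \<eta>"

text \<open>The absolute moment of order \<open>2 * \<gamma>\<close> of the component of \<eta>
  along a unit vector; its positive part accounts for half.\<close>

definition K :: real where
  "K = Beta (\<gamma> + 1/2) ((real CARD('n) - 1) / 2) / Beta (1/2) ((real CARD('n) - 1) / 2)"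

lemma K_pos: "K > 0"
  using Beta_real_pos[of "\<gamma> + 1/2" "(real CARD('n) - 1) / 2"] Beta_real_pos[of "1/2" "(real CARD('n) - 1) / 2"] n \<gamma>
  by (simp add: K_def)

sublocale S: spherical \<mu>
  by unfold_locales (rule \<eta>)

lemma M_nonempty: "M \<noteq> {}"
  using M(2) by auto

lemma measurable_B [measurable]: "B \<in> borel_measurable Q"
  using B by (simp add: distributed_def)

lemma measurable_V: "u \<in> M \<Longrightarrow> V u \<in> borel_measurable Q"
  using indep_B_V by (auto simp: indep_rvs_def)

lemma measurable_cos2_radius [measurable]: "cos2_radius M u \<in> borel_measurable borel"
  using continuous_on_cos2_radius by (rule borel_measurable_continuous_onI)

lemma measurable_cos2_radius_V: "u \<in> M \<Longrightarrow> (\<lambda>\<omega>. cos2_radius M u (V u \<omega>)) \<in> borel_measurable Q"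
  using measurable_compose[OF measurable_V measurable_cos2_radius] .

lemma AE_V: "u \<in> M \<Longrightarrow> AE \<omega> in Q. V u \<omega> \<in> unit_normals u"
proof -
  assume u: "u \<in> M"
  note [measurable] = measurable_V[OF u]
  have "AE v in distr Q borel (V u). v \<in> {v. v \<bullet> u = 0} \<and> norm v = 1"
    by (rule refl_uniformD(3)[OF V[OF u]])
  then show ?thesis
    by (subst (asm) AE_distr_iff) (auto simp: unit_normals_def)
qed

lemma AE_B_pos: "AE \<omega> in Q. 0 \<le> B \<omega>"
proof -
  have "AE x in distr Q lborel B. 0 \<le> x"
    unfolding distributed_distr_eq_density[OF B]
    by (subst AE_density) (auto simp: beta_density_def)
  then show ?thesis
    by (subst (asm) AE_distr_iff) auto
qed

lemma unit_normals_nonempty: "unit_normals (u :: real^'n) \<noteq> {}"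
proof -
  obtain x where x: "x \<noteq> 0" "u \<bullet> x = 0"
    using orthogonal_to_vector_exists[of u] n by (auto simp: orthogonal_def)
  then have "inverse (norm x) *\<^sub>R x \<in> unit_normals u"
    by (simp add: unit_normals_def inner_commute)
  then show ?thesis by blast
qed

section \<open>Limit weights as integrals over the sphere\<close>

lemma integral_cap:
  assumes u: "u \<in> M" and [measurable]: "g \<in> borel_measurable borel"
  shows "(\<integral>z. (max 0 (u \<bullet> z)) powr (2 * \<gamma>) * indicator {z. g (normal_dir u z) \<le> (u \<bullet> z)\<^sup>2} z \<partial>\<mu>) =
    K / 2 * measure Q {\<omega>\<in>space Q. g (V u \<omega>) \<le> B \<omega>}"
proof -
  interpret A: spherical_axis \<mu> u
    by unfold_locales (use n norm_M u in auto)
  let ?f = "\<lambda>z. (max 0 (u \<bullet> z)) powr (2 * \<gamma>) * indicator {z. g (normal_dir u z) \<le> (u \<bullet> z)\<^sup>2} z"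
  have "(\<integral>z. ?f z \<partial>\<mu>) = enn2real (\<integral>\<^sup>+z. ennreal (?f z) \<partial>\<mu>)"
    by (rule integral_eq_nn_integral) auto
  also have "(\<integral>\<^sup>+z. ennreal (?f z) \<partial>\<mu>) =
      (\<integral>\<^sup>+z. ennreal ((max 0 (u \<bullet> z)) powr (2 * \<gamma>)) * indicator {z. g (normal_dir u z) \<le> (u \<bullet> z)\<^sup>2} z \<partial>\<mu>)"
    by (intro nn_integral_cong) (simp add: indicator_def)
  finally have "2 * (\<integral>z. ?f z \<partial>\<mu>) = enn2real (2 * \<dots>)"
    by (simp add: enn2real_mult)
  also have "\<dots> = K * measure Q {\<omega>\<in>space Q. g (V u \<omega>) \<le> B \<omega>}"
    using K_pos unfolding A.nn_integral_sphere_cap[OF Q.prob_space_axioms \<gamma> B indep_B_V[OF u] V[OF u] assms(2)]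
    by (simp add: enn2real_mult Q.emeasure_eq_measure flip: K_def)
  finally show ?thesis by simp
qed

lemma integral_direction:
  assumes u: "u \<in> M"
  shows "(\<integral>z. (max 0 (u \<bullet> z)) powr (2 * \<gamma>) \<partial>\<mu>) = K / 2"
proof -
  \<comment> \<open>The threshold 0 imposes no condition: squares are nonnegative, and so is
    \<open>B\<close> almost surely.\<close>
  have "Q.prob {\<omega>\<in>space Q. 0 \<le> B \<omega>} = 1"
    using AE_B_pos by (subst Q.prob_Collect_eq_1) auto
  then show ?thesis
    using integral_cap[OF u, of "\<lambda>_. 0"] by simp
qed

text \<open>\<open>maximizer_iff\<close> applies except where \<open>u \<bullet> z \<le> 0\<close>,
  where the weight vanishes, and on a null set.\<close>

lemma integral_maximizer:
  assumes u: "u \<in> M"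
  shows "(\<integral>z. (max 0 (u \<bullet> z)) powr (2 * \<gamma>) * indicator {z. \<forall>w\<in>M. w \<bullet> z \<le> u \<bullet> z} z \<partial>\<mu>) =
    K / 2 * measure Q {\<omega>\<in>space Q. cos2_radius M u (V u \<omega>) \<le> B \<omega>}"
proof -
  interpret A: spherical_axis \<mu> u
    by unfold_locales (use n norm_M u in auto)
  note [measurable] = M(1)
  have "(\<integral>z. (max 0 (u \<bullet> z)) powr (2 * \<gamma>) * indicator {z. \<forall>w\<in>M. w \<bullet> z \<le> u \<bullet> z} z \<partial>\<mu>) =
      (\<integral>z. (max 0 (u \<bullet> z)) powr (2 * \<gamma>) * indicator {z. cos2_radius M u (normal_dir u z) \<le> (u \<bullet> z)\<^sup>2} z \<partial>\<mu>)"
  proof (rule integral_cong_AE)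
    show "AE z in \<mu>. (max 0 (u \<bullet> z)) powr (2 * \<gamma>) * indicator {z. \<forall>w\<in>M. w \<bullet> z \<le> u \<bullet> z} z =
        (max 0 (u \<bullet> z)) powr (2 * \<gamma>) * indicator {z. cos2_radius M u (normal_dir u z) \<le> (u \<bullet> z)\<^sup>2} z"
      using S.AE_sphere A.AE_inner_square_neq[of 1]
    proof eventually_elim
      case (elim z)
      show ?case
      proof (cases "u \<bullet> z > 0")
        case True
        then show ?thesis using maximizer_iff[OF u elim(1) True elim(2)] by (simp add: indicator_def)
      qed (use \<gamma> in \<open>simp add: max_def\<close>)
    qed
  qed measurable
  then show ?thesis
    using integral_cap[OF u measurable_cos2_radius] by simp
qed

text \<open>A tie means that \<open>z\<close> is orthogonal to the unit vector along
  \<open>u - w\<close>, which has probability 0.\<close>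

lemma AE_no_ties:
  assumes "u \<in> M" "w \<in> M" "u \<noteq> w"
  shows "AE z in \<mu>. u \<bullet> z \<noteq> w \<bullet> z"
proof -
  define e where "e = inverse (norm (u - w)) *\<^sub>R (u - w)"
  interpret A: spherical_axis \<mu> e
    by unfold_locales (use n assms in \<open>auto simp: e_def\<close>)
  show ?thesis
    using A.AE_inner_square_neq[of 0]
    by eventually_elim (auto simp: e_def inner_diff_left)
qed

text \<open>Almost surely a single point of \<open>M\<close> is the maximizer, so exactly one
  maximality indicator is nonzero and its summand carries the whole integrand.\<close>

lemma integral_max:
  "(\<integral>z. (max 0 (MAX u\<in>M. u \<bullet> z)) powr (2 * \<gamma>) \<partial>\<mu>) =
    (\<Sum>u\<in>M. K / 2 * measure Q {\<omega>\<in>space Q. cos2_radius M u (V u \<omega>) \<le> B \<omega>})"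
proof -
  note [measurable] = M(1)
  have cont: "continuous_on UNIV (\<lambda>z. MAX u\<in>M. u \<bullet> z)"
    using M(1) M_nonempty by (intro continuous_on_Max_image continuous_intros)
  let ?f = "\<lambda>u z. (max 0 (u \<bullet> z)) powr (2 * \<gamma>) * indicator {z. \<forall>w\<in>M. w \<bullet> z \<le> u \<bullet> z} z"
  have "(\<integral>z. (max 0 (MAX u\<in>M. u \<bullet> z)) powr (2 * \<gamma>) \<partial>\<mu>) = (\<integral>z. (\<Sum>u\<in>M. ?f u z) \<partial>\<mu>)"
  proof (rule integral_cong_AE)
    note borel_measurable_continuous_onI[OF cont, measurable]
    show "(\<lambda>z. (max 0 (MAX u\<in>M. u \<bullet> z)) powr (2 * \<gamma>)) \<in> borel_measurable \<mu>"
      by measurable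
    have "AE z in \<mu>. \<forall>u\<in>M. \<forall>w\<in>M. u \<noteq> w \<longrightarrow> u \<bullet> z \<noteq> w \<bullet> z"
      using M(1) AE_no_ties by (intro AE_finite_allI) auto
    then show "AE z in \<mu>. (max 0 (MAX u\<in>M. u \<bullet> z)) powr (2 * \<gamma>) = (\<Sum>u\<in>M. ?f u z)"
    proof eventually_elim
      case (elim z)
      have "(MAX u\<in>M. u \<bullet> z) \<in> (\<lambda>u. u \<bullet> z) ` M"
        using M(1) M_nonempty by (intro Max_in) auto
      then obtain u where u: "u \<in> M" "(MAX u\<in>M. u \<bullet> z) = u \<bullet> z" by auto
      have le: "w \<bullet> z \<le> u \<bullet> z" if "w \<in> M" for w
        unfolding u(2)[symmetric] using that M(1) by (intro Max_ge) auto
      have "(\<Sum>w\<in>M. ?f w z) = ?f u z + (\<Sum>w\<in>M - {u}. ?f w z)"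
        using M(1) u(1) by (rule sum.remove)
      also have "(\<Sum>w\<in>M - {u}. ?f w z) = 0"
      proof (intro sum.neutral ballI)
        fix w assume "w \<in> M - {u}"
        then have "w \<bullet> z < u \<bullet> z" using le[of w] elim u(1) by (metis DiffD1 DiffD2 insertI1 order.not_eq_order_implies_strict)
        then have "\<not> (\<forall>x\<in>M. x \<bullet> z \<le> w \<bullet> z)" using u(1) by force
        then show "?f w z = 0" by (simp add: indicator_def)
      qed
      also have "?f u z = (max 0 (MAX u\<in>M. u \<bullet> z)) powr (2 * \<gamma>)"
        using le by (simp add: u(2))
      finally show ?case by simp
    qed
  qed measurable
  also have "\<dots> = (\<Sum>u\<in>M. \<integral>z. ?f u z \<partial>\<mu>)"
  proof (rule Bochner_Integration.integral_sum)
    fix u assume u: "u \<in> M"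
    show "integrable \<mu> (?f u)"
    proof (rule S.integrable_sphere[where C = 1])
      fix z :: "real^'n" assume "norm z = 1"
      then have "u \<bullet> z \<le> 1"
        using norm_cauchy_schwarz[of u z] norm_M[OF u] by simp
      then have "max 0 (u \<bullet> z) powr (2 * \<gamma>) \<le> 1 powr (2 * \<gamma>)"
        using \<gamma> by (intro powr_mono2) auto
      then show "\<bar>?f u z\<bar> \<le> 1"
        by (simp add: indicator_def)
    qed measurable
  qed
  also have "\<dots> = (\<Sum>u\<in>M. K / 2 * measure Q {\<omega>\<in>space Q. cos2_radius M u (V u \<omega>) \<le> B \<omega>})"
    by (intro sum.cong integral_maximizer) auto
  finally show ?thesis .
qed

text \<open>The share of the limiting weight of \<open>u\<close> that is lost in passing from the
  sum of probabilities to the probability of the maximum.\<close>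

definition p :: "real^'n \<Rightarrow> real" where
  "p u = measure Q {\<omega>\<in>space Q. B \<omega> < cos2_radius M u (V u \<omega>)}"

lemma p_compl:
  assumes "u \<in> M"
  shows "measure Q {\<omega>\<in>space Q. cos2_radius M u (V u \<omega>) \<le> B \<omega>} = 1 - p u"
proof -
  note [measurable] = measurable_cos2_radius_V[OF assms]
  have "measure Q {\<omega>\<in>space Q. \<not> B \<omega> < cos2_radius M u (V u \<omega>)} = 1 - p u"
    unfolding p_def by (rule Q.prob_neg) measurable
  then show ?thesis by (simp add: not_less)
qed

text \<open>Dividing by \<open>tail (c\<^sup>2)\<close>, each summand tends to \<open>K / 2\<close>,
  and the probability of the maximum tends to the sum of the \<open>K / 2 * (1 - p u)\<close>. The
  factor \<open>K / 2\<close> cancels in the quotient.\<close>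

lemma bonferroni_error_tendsto: "(bonferroni_error P \<xi> M \<longlongrightarrow> 1 / real (card M) * (\<Sum>u\<in>M. p u)) at_top"
proof -
  have N: "real (card M) > 0" using M(2) by simp
  have single: "((\<lambda>c. prob {\<omega>\<in>space P. c \<le> u \<bullet> \<xi> \<omega>} / tail (c\<^sup>2)) \<longlongrightarrow> K / 2) at_top" if u: "u \<in> M" for u
    unfolding integral_direction[OF u, symmetric]
  proof (rule directional_tail)
    fix y :: "real^'n" assume "norm y = 1"
    then show "u \<bullet> y \<le> 1"
      using norm_cauchy_schwarz[of u y] norm_M[OF u] by simp
  qed auto
  have sum: "((\<lambda>c. bonferroni_sum P \<xi> M c / tail (c\<^sup>2)) \<longlongrightarrow> (\<Sum>u\<in>M. K / 2)) at_top"
    unfolding bonferroni_sum_def sum_divide_distrib by (intro tendsto_sum single)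
  have max: "((\<lambda>c. prob {\<omega>\<in>space P. c \<le> (MAX u\<in>M. u \<bullet> \<xi> \<omega>)} / tail (c\<^sup>2)) \<longlongrightarrow> (\<Sum>u\<in>M. K / 2 * (1 - p u))) at_top"
  proof -
    have "continuous_on UNIV (\<lambda>z :: real^'n. MAX u\<in>M. u \<bullet> z)"
      using M(1) M_nonempty by (intro continuous_on_Max_image continuous_intros)
    then have meas: "(\<lambda>z :: real^'n. MAX u\<in>M. u \<bullet> z) \<in> borel_measurable borel"
      by (rule borel_measurable_continuous_onI)
    have hom: "(MAX u\<in>M. u \<bullet> (x *\<^sub>R y)) = x * (MAX u\<in>M. u \<bullet> y)" if "x > 0" for x and y :: "real^'n"
    proof -
      have "mono ((*) x)" using that by (intro monoI mult_left_mono) auto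
      from mono_Max_commute[OF this, of "(\<lambda>u. u \<bullet> y) ` M"] show ?thesis
        using M(1) M_nonempty by (simp add: image_image)
    qed
    have le: "(MAX u\<in>M. u \<bullet> y) \<le> 1" if y: "norm y = 1" for y :: "real^'n"
    proof -
      have "u \<bullet> y \<le> 1" if "u \<in> M" for u
        using norm_cauchy_schwarz[of u y] norm_M[OF that] y by simp
      then show ?thesis using M(1) M_nonempty by simp
    qed
    have "(\<integral>z. (max 0 (MAX u\<in>M. u \<bullet> z)) powr (2 * \<gamma>) \<partial>\<mu>) = (\<Sum>u\<in>M. K / 2 * (1 - p u))"
      unfolding integral_max by (intro sum.cong refl arg_cong2[where f = "(*)"] p_compl)
    then show ?thesis
      using directional_tail[OF meas hom le] by simp
  qed
  have "((\<lambda>c. (bonferroni_sum P \<xi> M c / tail (c\<^sup>2) - prob {\<omega>\<in>space P. c \<le> (MAX u\<in>M. u \<bullet> \<xi> \<omega>)} / tail (c\<^sup>2)) /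
      (bonferroni_sum P \<xi> M c / tail (c\<^sup>2))) \<longlongrightarrow> ((\<Sum>u\<in>M. K / 2) - (\<Sum>u\<in>M. K / 2 * (1 - p u))) / (\<Sum>u\<in>M. K / 2)) at_top"
    using N K_pos by (intro tendsto_intros sum max) auto
  also have "((\<Sum>u\<in>M. K / 2) - (\<Sum>u\<in>M. K / 2 * (1 - p u))) / (\<Sum>u\<in>M. K / 2) = 1 / real (card M) * (\<Sum>u\<in>M. p u)"
  proof -
    have "(\<Sum>u\<in>M. K / 2 * (1 - p u)) = (\<Sum>u\<in>M. K / 2) - K / 2 * (\<Sum>u\<in>M. p u)"
      by (simp add: right_diff_distrib sum_subtractf sum_distrib_left)
    then show ?thesis using N K_pos by simp
  qed
  finally show ?thesis
  proof (rule Lim_transform_eventually)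
    show "eventually (\<lambda>c. (bonferroni_sum P \<xi> M c / tail (c\<^sup>2) - prob {\<omega>\<in>space P. c \<le> (MAX u\<in>M. u \<bullet> \<xi> \<omega>)} / tail (c\<^sup>2)) /
        (bonferroni_sum P \<xi> M c / tail (c\<^sup>2)) = bonferroni_error P \<xi> M c) at_top"
      using eventually_gt_at_top[of 0]
    proof eventually_elim
      case (elim c)
      then have "tail (c\<^sup>2) > 0" by (intro tail_pos) simp
      then show ?case by (simp add: bonferroni_error_def flip: diff_divide_distrib)
    qed
  qed
qed

section \<open>Positivity of the limit and comparison with the critical radius\<close>

text \<open>By independence the probability is a product, positive because the Beta density is
  positive inside the unit interval and the uniform law has full support.\<close>

lemma beta_normal_event_pos:
  assumes u: "u \<in> M" and v: "v \<in> unit_normals u" and U: "open U" "v \<in> U" and "0 \<le> a" "a < b" "b \<le> 1"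
  shows "measure Q {\<omega>\<in>space Q. B \<omega> \<in> {a<..<b} \<and> V u \<omega> \<in> U} > 0"
proof -
  note [measurable] = measurable_V[OF u]
  have "measure (distr Q borel (V u)) U > 0"
    using U v by (intro refl_uniform_full_support[OF V[OF u] subspace_orthogonal_vector, of v])
      (auto simp: unit_normals_def)
  then have "measure Q {\<omega>\<in>space Q. V u \<omega> \<in> U} > 0"
    using U by (subst (asm) measure_distr) (auto simp: vimage_def Int_def conj_commute)
  moreover have "measure Q {\<omega>\<in>space Q. B \<omega> \<in> {a<..<b}} > 0"
    using beta_distributed_interval_pos[OF Q.prob_space_axioms B _ _ assms(5-7)] n \<gamma> by simp
  ultimately show ?thesis
    using U indep_rvs_prob[OF Q.prob_space_axioms indep_B_V[OF u], of "{a<..<b}" U] by simp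
qed

text \<open>By continuity \<open>cos2_radius\<close> stays above half its value at \<open>v\<close>
  near \<open>v\<close>, and \<open>B\<close> lies below that half with positive
  probability.\<close>

lemma p_pos:
  assumes u: "u \<in> M" and v: "v \<in> unit_normals u" and pos: "cos2_radius M u v > 0"
  shows "p u > 0"
proof -
  note [measurable] = measurable_V[OF u]
  define a where "a = cos2_radius M u v / 2"
  define U where "U = {w. a < cos2_radius M u w}"
  have "open U"
    unfolding U_def by (intro open_Collect_less continuous_on_cos2_radius continuous_intros)
  then have "0 < measure Q {\<omega>\<in>space Q. B \<omega> \<in> {0<..<a} \<and> V u \<omega> \<in> U}"
    using pos cos2_radius_bounds(2)[of M u v]
    by (intro beta_normal_event_pos[OF u v]) (auto simp: U_def a_def)
  also have "\<dots> \<le> p u"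
    unfolding p_def by (intro Q.finite_measure_mono) (auto simp: U_def)
  finally show ?thesis .
qed

text \<open>The cosine decreases between 0 and \<open>pi\<close>, and it is nonnegative at the local
  radius, so the inequality survives squaring.\<close>

lemma cos2_radius_le_critical:
  assumes u: "u \<in> M" and v: "v \<in> unit_normals u"
  shows "cos2_radius M u v \<le> (cos (critical_radius M))\<^sup>2"
proof -
  have bdd: "bdd_below (local_critical_radius M w ` unit_normals w)" for w
    using local_critical_radius(1) by (intro bdd_belowI[of _ 0]) auto
  have "critical_radius M \<le> (INF v\<in>unit_normals u. local_critical_radius M u v)"
    unfolding critical_radius_def using M(1) u by (intro Min_le) auto
  also have "\<dots> \<le> local_critical_radius M u v"
    using bdd v by (rule cINF_lower)
  finally have le: "critical_radius M \<le> local_critical_radius M u v" .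
  have "critical_radius M \<ge> 0"
    unfolding critical_radius_def using M(1) M_nonempty unit_normals_nonempty local_critical_radius(1)
    by (auto intro!: cINF_greatest)
  then have "cos (local_critical_radius M u v) \<le> cos (critical_radius M)"
    using le local_critical_radius(2)[of M u v] by (intro cos_monotone_0_pi_le) auto
  moreover have "cos (local_critical_radius M u v) \<ge> 0"
    using local_critical_radius(1,2)[of M u v] by (intro cos_ge_zero) auto
  ultimately show ?thesis
    unfolding local_critical_radius(3)[symmetric] by (intro power_mono)
qed

lemma p_le_bar:
  assumes u: "u \<in> M"
  shows "p u \<le> measure Q {\<omega>\<in>space Q. B \<omega> < (cos (critical_radius M))\<^sup>2}"
  unfolding p_def
proof (rule Q.finite_measure_mono_AE)
  show "AE \<omega> in Q. \<omega> \<in> {\<omega>\<in>space Q. B \<omega> < cos2_radius M u (V u \<omega>)} \<longrightarrow>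
      \<omega> \<in> {\<omega>\<in>space Q. B \<omega> < (cos (critical_radius M))\<^sup>2}"
    using AE_V[OF u] by eventually_elim (use cos2_radius_le_critical[OF u] in force)
qed measurable

lemma p_less_bar:
  assumes u: "u \<in> M" and v: "v \<in> unit_normals u" and less: "cos2_radius M u v < (cos (critical_radius M))\<^sup>2"
  shows "p u < measure Q {\<omega>\<in>space Q. B \<omega> < (cos (critical_radius M))\<^sup>2}"
proof -
  note [measurable] = measurable_V[OF u]
  define k where "k = (cos (critical_radius M))\<^sup>2"
  have "k \<le> 1" by (simp add: k_def abs_square_le_1)
  \<comment> \<open>With the midpoint \<open>a\<close>, the event \<open>E\<close> is disjoint from
    \<open>F\<close>, has positive probability and still satisfies
    \<open>B \<omega> < k\<close>.\<close>
  define a where "a = (cos2_radius M u v + k) / 2"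
  have a: "cos2_radius M u v < a" "a < k" "0 \<le> a"
    using less cos2_radius_bounds(1)[of M u v] by (auto simp: a_def k_def)
  define U where "U = {w. cos2_radius M u w < a}"
  have U: "open U"
    unfolding U_def by (intro open_Collect_less continuous_on_cos2_radius continuous_intros)
  define E where "E = {\<omega>\<in>space Q. B \<omega> \<in> {a<..<k} \<and> V u \<omega> \<in> U}"
  define F where "F = {\<omega>\<in>space Q. B \<omega> < cos2_radius M u (V u \<omega>)}"
  have [measurable]: "U \<in> sets borel" using U by simp
  have [measurable]: "E \<in> sets Q" "F \<in> sets Q"
    unfolding E_def F_def by measurable
  have "0 < measure Q E"
    unfolding E_def using U a \<open>k \<le> 1\<close> by (intro beta_normal_event_pos[OF u v]) (auto simp: U_def)
  then have "p u < measure Q F + measure Q E"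
    by (simp add: p_def F_def)
  also have "\<dots> = measure Q (F \<union> E)"
    by (intro Q.finite_measure_Union[symmetric]) (auto simp: E_def F_def U_def)
  also have "\<dots> \<le> measure Q {\<omega>\<in>space Q. B \<omega> < k}"
  proof (rule Q.finite_measure_mono_AE)
    show "AE \<omega> in Q. \<omega> \<in> F \<union> E \<longrightarrow> \<omega> \<in> {\<omega>\<in>space Q. B \<omega> < k}"
      using AE_V[OF u]
      by eventually_elim (use cos2_radius_le_critical[OF u] in \<open>force simp: E_def F_def k_def\<close>)
  qed measurable
  finally show ?thesis by (simp add: k_def)
qed

text \<open>Asymptotic equivalence to a zero limit requires the error to vanish eventually, not
  merely to tend to 0.\<close>

lemma antipodal_error_eq_0:
  assumes "antipodal_pair M" "c > 0"
  shows "bonferroni_error P \<xi> M c = 0"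
proof -
  obtain u where u: "M = {u, - u}" using assms by (auto simp: antipodal_pair_def)
  have "u \<noteq> - u"
  proof
    assume "u = - u"
    then have "M = {u}" using u by simp
    then show False using M(2) by simp
  qed
  then have "bonferroni_sum P \<xi> M c = prob {\<omega>\<in>space P. c \<le> u \<bullet> \<xi> \<omega>} + prob {\<omega>\<in>space P. c \<le> - u \<bullet> \<xi> \<omega>}"
    by (simp add: bonferroni_sum_def u)
  also have "\<dots> = prob ({\<omega>\<in>space P. c \<le> u \<bullet> \<xi> \<omega>} \<union> {\<omega>\<in>space P. c \<le> - u \<bullet> \<xi> \<omega>})"
    using assms(2) by (intro finite_measure_Union[symmetric]) auto
  also have "{\<omega>\<in>space P. c \<le> u \<bullet> \<xi> \<omega>} \<union> {\<omega>\<in>space P. c \<le> - u \<bullet> \<xi> \<omega>} = {\<omega>\<in>space P. (MAX u\<in>M. u \<bullet> \<xi> \<omega>) \<ge> c}"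
    by (auto simp: u le_max_iff_disj)
  finally show ?thesis by (simp add: bonferroni_error_def)
qed

theorem bonferroni_error_limit:
  defines "L \<equiv> 1 / real (card M) * (\<Sum>u\<in>M. p u)"
    and "\<Delta>_bar \<equiv> measure Q {\<omega>\<in>space Q. B \<omega> < (cos (critical_radius M))\<^sup>2}"
  shows "bonferroni_error P \<xi> M \<sim>[at_top] (\<lambda>_. L)
    \<and> (bonferroni_error P \<xi> M \<longlongrightarrow> L) at_top
    \<and> (\<not> antipodal_pair M \<longrightarrow> 0 < L \<and> \<not> bonferroni_tail_valid P \<xi> M)
    \<and> L \<le> \<Delta>_bar
    \<and> (\<not> antipodal_pair M \<and> \<not> (CARD('n) = 2 \<and> regular_polygon M) \<longrightarrow> L < \<Delta>_bar)"
proof -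
  have N: "real (card M) > 0" using M(2) by simp
  have lim: "(bonferroni_error P \<xi> M \<longlongrightarrow> L) at_top"
    unfolding L_def by (rule bonferroni_error_tendsto)
  have pos: "0 < L" if "\<not> antipodal_pair M"
  proof -
    have "\<not> (\<forall>u\<in>M. \<forall>v\<in>unit_normals u. max_cot M u v \<le> 0)"
      using that antipodal_if_max_cot_nonpos by auto
    then obtain u v where uv: "u \<in> M" "v \<in> unit_normals u" "\<not> max_cot M u v \<le> 0"
      by blast
    then have "cos2_radius M u v \<noteq> 0" using cos2_radius_eq_0_D by blast
    then have "p u > 0"
      using cos2_radius_bounds(1)[of M u v] by (intro p_pos[OF uv(1,2)]) simp
    then have "(\<Sum>u\<in>M. p u) > 0"
      using M(1) uv(1) by (intro sum_pos2[of M u]) (auto simp: p_def)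
    then show ?thesis using N by (simp add: L_def)
  qed
  have asymp: "bonferroni_error P \<xi> M \<sim>[at_top] (\<lambda>_. L)"
  \<comment> \<open>Equivalence to the zero function means eventual equality with it, so this case
    cannot be read off from the limit.\<close>
  proof (cases "L = 0")
    case True
    then have "antipodal_pair M" using pos by force
    then have "eventually (\<lambda>c. bonferroni_error P \<xi> M c = L) at_top"
      by (intro eventually_mono[OF eventually_gt_at_top[of 0]]) (simp add: antipodal_error_eq_0 True)
    then show ?thesis by (rule asymp_equiv_refl_ev)
  next
    case False
    then show ?thesis using lim by (rule tendsto_imp_asymp_equiv_const[rotated])
  qed
  have invalid: "\<not> bonferroni_tail_valid P \<xi> M" if "\<not> antipodal_pair M"
    using tendsto_unique[OF trivial_limit_at_top_linorder lim] pos[OF that]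
    by (auto simp: bonferroni_tail_valid_def)
  have bar: "(\<Sum>u\<in>M. \<Delta>_bar) = real (card M) * \<Delta>_bar" by simp
  have "(\<Sum>u\<in>M. p u) \<le> (\<Sum>u\<in>M. \<Delta>_bar)"
    unfolding \<Delta>_bar_def by (intro sum_mono p_le_bar)
  then have le: "L \<le> \<Delta>_bar"
    unfolding bar L_def using N by (simp add: field_simps)
  have less: "L < \<Delta>_bar" if nd: "\<not> antipodal_pair M" "\<not> (CARD('n) = 2 \<and> regular_polygon M)"
  proof -
    \<comment> \<open>Otherwise \<open>cos2_radius\<close> equals its upper bound at every point and
      unit normal, so the cut-off \<open>max_cot\<close> is one constant for all of \<open>M\<close>
      and the configuration is degenerate.\<close>
    have "\<exists>u\<in>M. \<exists>v\<in>unit_normals u. cos2_radius M u v < (cos (critical_radius M))\<^sup>2"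
    proof (rule ccontr)
      assume "\<not> ?thesis"
      then have eq: "cos2_radius M u v = (cos (critical_radius M))\<^sup>2" if "u \<in> M" "v \<in> unit_normals u" for u v
        using cos2_radius_le_critical[OF that] that by force
      obtain u0 v0 where "u0 \<in> M" "v0 \<in> unit_normals u0"
        using M_nonempty unit_normals_nonempty by blast
      then have "max 0 (max_cot M u v) = max 0 (max_cot M u0 v0)" if "u \<in> M" "v \<in> unit_normals u" for u v
        using eq that by (intro cos2_radius_eq_D) simp
      then show False using degenerate_if_max_cot_const[OF n] nd by blast
    qed
    then obtain u where "u \<in> M" "p u < \<Delta>_bar"
      unfolding \<Delta>_bar_def using p_less_bar by blast
    then have "(\<Sum>u\<in>M. p u) < (\<Sum>u\<in>M. \<Delta>_bar)"
      using M(1) p_le_bar by (intro sum_strict_mono_ex1) (auto simp: \<Delta>_bar_def)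
    then show ?thesis
      unfolding bar L_def using N by (simp add: field_simps)
  qed
  show ?thesis using asymp lim pos invalid le less by blast
qed

end

theorem theorem3:
  fixes P :: "'a measure" and Q :: "'b measure"
    and \<xi> :: "'a \<Rightarrow> real^'n" and M :: "(real^'n) set" and \<gamma> :: real
    and B :: "'b \<Rightarrow> real" and V :: "real^'n \<Rightarrow> 'b \<Rightarrow> real^'n"
  defines "L \<equiv> 1 / real (card M) *
      (\<Sum>u\<in>M. measure Q {\<omega>\<in>space Q. B \<omega> < (cos (local_critical_radius M u (V u \<omega>)))\<^sup>2})"
    and "\<Delta>_bar \<equiv> measure Q {\<omega>\<in>space Q. B \<omega> < (cos (critical_radius M))\<^sup>2}"
  assumes "CARD('n) \<ge> 2"
    and "finite M" and "card M \<ge> 2" and "M \<subseteq> sphere 0 1"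
    and "prob_space P" and "spherically_contoured P \<xi>"
    and "0 < \<gamma>" and "cdf (distr P borel (\<lambda>\<omega>. (norm (\<xi> \<omega>))\<^sup>2)) \<in> RV (- \<gamma>)"
    and "prob_space Q"
    and "distributed Q lborel B
           (\<lambda>x. ennreal (beta_density (\<gamma> + 1/2) ((real CARD('n) - 1) / 2) x))"
    and "\<And>u. u \<in> M \<Longrightarrow> indep_rvs Q B (V u)"
    and "\<And>u. u \<in> M \<Longrightarrow> uniform_on_sphere (unit_normals u) (distr Q borel (V u))"
  shows "bonferroni_error P \<xi> M \<sim>[at_top] (\<lambda>_. L)
    \<and> (bonferroni_error P \<xi> M \<longlongrightarrow> L) at_top
    \<and> (\<not> antipodal_pair M \<longrightarrow> 0 < L \<and> \<not> bonferroni_tail_valid P \<xi> M)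
    \<and> L \<le> \<Delta>_bar
    \<and> (\<not> antipodal_pair M \<and> \<not> (CARD('n) = 2 \<and> regular_polygon M) \<longrightarrow> L < \<Delta>_bar)"
proof -
  interpret P: prob_space P by fact
  obtain r :: "'a \<Rightarrow> real" and \<eta> where r\<eta>: "indep_rvs P r \<eta>" "AE \<omega> in P. 0 < r \<omega>"
      "uniform_on_sphere (sphere 0 1) (distr P borel \<eta>)" "\<And>\<omega>. \<omega> \<in> space P \<Longrightarrow> \<xi> \<omega> = r \<omega> *\<^sub>R \<eta> \<omega>"
    using assms(8) unfolding spherically_contoured_def by blast
  have \<eta>: "refl_uniform UNIV (distr P borel \<eta>)"
    using r\<eta>(3) by (rule uniform_on_sphere_imp_refl_uniform) (auto simp: sphere_def dist_norm)
  have [measurable]: "\<eta> \<in> borel_measurable P" using r\<eta>(1) by (simp add: indep_rvs_def)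
  have \<eta>_norm: "AE \<omega> in P. norm (\<eta> \<omega>) = 1"
    using refl_uniformD(3)[OF \<eta>] by (subst (asm) AE_distr_iff) auto
  interpret Q: prob_space Q by fact
  interpret bonferroni_setting M P r \<eta> \<xi> \<gamma> Q B V
  proof
    show "refl_uniform {v. v \<bullet> u = 0} (distr Q borel (V u))" if "u \<in> M" for u
      using assms(14)[OF that]
      by (rule uniform_on_sphere_imp_refl_uniform) (auto simp: unit_normals_def subspace_orthogonal_vector)
  qed (use assms r\<eta> \<eta> \<eta>_norm in auto)
  show ?thesis
    using bonferroni_error_limit unfolding L_def \<Delta>_bar_def p_def local_critical_radius(3) .
qed

end
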